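(* Let $d \ge 1$. The set function $\operatorname{cap}^* = \operatorname{cap}^*_{h^2_d}$, defined on all subsets of $\partial\mathbb{B}_d$, is a Choquet capacity, i.e. the following properties hold: (a) $\operatorname{cap}^*(\emptyset) = 0$; (b) if $E \subset F \subset \partial\mathbb{B}_d$, then $\operatorname{cap}^*(E) \le \operatorname{cap}^*(F)$; (c) if $(E_n)_{n\ge1}$ is a decreasing sequence of compact subsets of $\partial\mathbb{B}_d$, then $\operatorname{cap}^*\big(\bigcap_{n=1}^\infty E_n\big) = \lim_{n\to\infty}\operatorname{cap}^*(E_n)$; (d) if $(E_n)_{n\ge1}$ is an increasing sequence of arbitrary subsets of $\partial\mathbb{B}_d$, then $\operatorname{cap}^*\big(\bigcup_{n=1}^\infty E_n\big) = \lim_{n\to\infty}\operatorname{cap}^*(E_n)$. Therefore, all Borel subsets of $\partial\mathbb{B}_d$ are capacitable, i.e. their inner and outer $h^2_d$-capacities agree.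
   Context: $\mathbb{B}_d$ is the open Euclidean unit ball of $\mathbb{C}^d$, with boundary sphere $\partial\mathbb{B}_d$. The pluriharmonic Drury--Arveson space $h^2_d$ is the reproducing kernel Hilbert space on $\mathbb{B}_d$ with kernel $$k(z,w) = 2\operatorname{Re}\frac{1}{1 - \langle z,w\rangle} - 1 = \frac{1 - |\langle z,w\rangle|^2}{|1 - \langle z,w\rangle|^2}.$$ The $h^2_d$-energy of a Borel probability measure $\mu$ on $\partial\mathbb{B}_d$ is $\mathcal{E}(\mu) = \sup_{0 \le r < 1} \int\int k(rz,rw)\, d\mu(w)\, d\mu(z) \in [0,\infty]$. For compact $F \subset \partial\mathbb{B}_d$, $\operatorname{cap}_{h^2_d}(F) = \sup\{1/\mathcal{E}(\mu) : \mu$ a Borel probability measure supported on $F\}$ (with $1/\infty = 0$ and $\operatorname{cap}(\emptyset) = 0$). For arbitrary $E \subset \partial\mathbb{B}_d$, the inner capacity is $\operatorname{cap}_{h^2_d}(E) = \sup\{\operatorname{cap}_{h^2_d}(F) : F \subset E \text{ compact}\}$ and the outer capacity is $\operatorname{cap}^*_{h^2_d}(E) = \inf\{\operatorname{cap}_{h^2_d}(G) : G \supset E,\ G \text{ open in } \partial\mathbb{B}_d\}$. *)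

theory Defs
  imports "HOL-Probability.Probability"
begin

text \<open>
  The space \<open>\<complex>\<^sup>d\<close> is rendered as \<^typ>\<open>complex ^ 'd\<close> with \<open>d = CARD('d)\<close>, whose library norm is the
  Euclidean one. So \<open>ball 0 1\<close> is the open unit ball and \<open>sphere 0 1\<close> its boundary.
\<close>

definition cinner :: "complex ^ 'd \<Rightarrow> complex ^ 'd \<Rightarrow> complex" where
  "cinner z w = (\<Sum>i\<in>UNIV. z $ i * cnj (w $ i))"

definition h2d_kernel :: "complex ^ 'd \<Rightarrow> complex ^ 'd \<Rightarrow> real" where
  "h2d_kernel z w = 2 * Re (1 / (1 - cinner z w)) - 1"

lemma norm_cinner_le: "norm (cinner z w) \<le> norm z * norm w"
proof -
  have "norm (cinner z w) \<le> (\<Sum>i\<in>UNIV. norm (z $ i) * norm (w $ i))"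
    unfolding cinner_def by (rule order_trans[OF norm_sum]) (simp add: norm_mult)
  also have "\<dots> \<le> norm z * norm w"
    unfolding norm_vec_def
    using L2_set_mult_ineq[of "\<lambda>i. norm (z $ i)" "\<lambda>i. norm (w $ i)" UNIV] by simp
  finally show ?thesis .
qed

lemma norm_cinner_less_one:
  assumes "z \<in> ball 0 1" "w \<in> ball 0 1"
  shows "norm (cinner z w) < 1"
proof -
  have "norm z * norm w < 1"
    using assms mult_strict_mono'[of "norm z" 1 "norm w" 1] by simp
  then show ?thesis
    using norm_cinner_le[of z w] by linarith
qed

lemma h2d_kernel_alt:
  assumes "z \<in> ball 0 1" "w \<in> ball 0 1"
  shows "h2d_kernel z w = (1 - (norm (cinner z w))\<^sup>2) / (norm (1 - cinner z w))\<^sup>2"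
proof -
  define u where "u = cinner z w"
  have "norm u < 1"
    unfolding u_def by (rule norm_cinner_less_one[OF assms])
  then have "u \<noteq> 1" by auto
  then have nz: "(1 - Re u)\<^sup>2 + (Im u)\<^sup>2 \<noteq> 0"
    by (auto simp: complex_eq_iff sum_power2_eq_zero_iff)
  define D where "D = (1 - Re u)\<^sup>2 + (Im u)\<^sup>2"
  have "2 * Re (1 / (1 - u)) - 1 = 2 * ((1 - Re u) / D) - 1"
    by (simp add: Re_divide D_def)
  also have "\<dots> = (2 * (1 - Re u) - D) / D"
    using nz by (simp add: D_def[symmetric] diff_divide_distrib)
  also have "2 * (1 - Re u) - D = 1 - (norm u)\<^sup>2"
    by (simp add: D_def cmod_power2) (simp add: power2_eq_square algebra_simps)
  also have "D = (norm (1 - u))\<^sup>2"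
    by (simp add: D_def cmod_power2)
  finally have "2 * Re (1 / (1 - u)) - 1 = (1 - (norm u)\<^sup>2) / (norm (1 - u))\<^sup>2" .
  then show ?thesis
    unfolding h2d_kernel_def u_def .
qed

lemma h2d_kernel_pos:
  assumes "z \<in> ball 0 1" "w \<in> ball 0 1"
  shows "h2d_kernel z w > 0"
proof -
  have n: "norm (cinner z w) < 1" by (rule norm_cinner_less_one[OF assms])
  then have "cinner z w \<noteq> 1" by auto
  moreover have "(norm (cinner z w))\<^sup>2 < 1" using n by (simp add: power_less_one_iff abs_square_less_1)
  ultimately show ?thesis
    by (simp add: h2d_kernel_alt[OF assms])
qed

definition sphere_prob :: "(complex ^ 'd) measure \<Rightarrow> bool" where
  "sphere_prob M \<longleftrightarrow> prob_space M \<and> sets M = sets (restrict_space borel (sphere 0 1))"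

text \<open>
  For \<open>r < 1\<close> the integrand is continuous, bounded and positive (\<open>h2d_kernel_pos\<close>), so the
  Bochner integrals exist and \<^const>\<open>ennreal\<close> truncates nothing.
\<close>

definition h2d_energy :: "(complex ^ 'd) measure \<Rightarrow> ennreal" where
  "h2d_energy M =
     (SUP r\<in>{0..<1::real}. ennreal (LINT z|M. LINT w|M. h2d_kernel (r *\<^sub>R z) (r *\<^sub>R w)))"

text \<open>
  The supremum is taken in \<^typ>\<open>ennreal\<close>, where \<open>1 / \<infinity> = 0\<close> and the supremum of the empty set
  is \<open>0\<close>; the latter gives the empty set capacity \<open>0\<close>. Division by \<open>0\<close> does not occur,
  since the energy of a probability measure is at least \<open>h2d_kernel 0 0 = 1\<close>.
\<close>

definition cap_compact :: "(complex ^ 'd) set \<Rightarrow> ennreal" where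
  "cap_compact F =
     (SUP M\<in>{M. sphere_prob M \<and> emeasure M (sphere 0 1 - F) = 0}. 1 / h2d_energy M)"

definition inner_cap :: "(complex ^ 'd) set \<Rightarrow> ennreal" where
  "inner_cap E = (SUP F\<in>{F. compact F \<and> F \<subseteq> E}. cap_compact F)"

definition outer_cap :: "(complex ^ 'd) set \<Rightarrow> ennreal" where
  "outer_cap E = (INF G\<in>{G. openin (top_of_set (sphere 0 1)) G \<and> E \<subseteq> G}. inner_cap G)"

definition choquet_capacity_on :: "'a::topological_space set \<Rightarrow> ('a set \<Rightarrow> ennreal) \<Rightarrow> bool" where
  "choquet_capacity_on S c \<longleftrightarrow>
     c {} = 0 \<and>
     (\<forall>E F. E \<subseteq> F \<longrightarrow> F \<subseteq> S \<longrightarrow> c E \<le> c F) \<and>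
     (\<forall>E :: nat \<Rightarrow> 'a set. decseq E \<longrightarrow> (\<forall>n. compact (E n) \<and> E n \<subseteq> S) \<longrightarrow>
        (\<lambda>n. c (E n)) \<longlonglongrightarrow> c (\<Inter>n. E n)) \<and>
     (\<forall>E :: nat \<Rightarrow> 'a set. incseq E \<longrightarrow> (\<forall>n. E n \<subseteq> S) \<longrightarrow>
        (\<lambda>n. c (E n)) \<longlonglongrightarrow> c (\<Union>n. E n))"

definition capacitable :: "(complex ^ 'd) set \<Rightarrow> bool" where
  "capacitable E \<longleftrightarrow> inner_cap E = outer_cap E"

end

theory Submission
  imports Defs
begin

text \<open>
  Expanding the kernel shows that the energy of \<open>\<mu>\<close> is the sum of the squares of its moments against
  countably many pluriharmonic polynomials. Since the kernel is positive, restricting a measure to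
  disjoint sets superadds energies, which makes the capacity countably subadditive on Borel sets.

  For an increasing union \<open>\<Union>n. E n\<close> with all outer capacities below \<open>t\<close>, a truncated potential of a
  near-minimal measure gives a polynomial \<open>p\<close> with \<open>\<parallel>p\<parallel>\<^sup>2 \<le> t\<close> whose integral against every measure \<open>\<mu>\<close>
  living near \<open>E n\<close> is at least \<open>1 - \<tau> * energy \<mu>\<close>. Such polynomials form midpoint convex sets
  decreasing in \<open>n\<close>, so near-minimisers of the norm are Cauchy. By Chebyshev's inequality for
  the capacity the resulting polynomials differ little from the first one off an open set of small
  capacity, and where the first one exceeds \<open>1 - 3 * \<epsilon>\<close> the capacity is at most \<open>t / (1 - 3 * \<epsilon>)\<^sup>2\<close>.

  Capacitability is Choquet's theorem. It needs that outer capacity and capacity agree on compact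
  sets, which holds because weak limits of probability measures do not increase the energy; the weak
  limits come from Helly's theorem on the line via a Borel coding of a compact set by real numbers.
\<close>

subsection \<open>The energy as a sum of squared moments\<close>

text \<open>The kernel is singular on the boundary diagonal and elements of h^2_d need not have
  values at single boundary points, yet outer capacity asks for open sets containing every point of
  \<open>E n\<close>. Potentials are therefore truncated to polynomials, whose strict superlevel
  sets are open. Truncation and mere near-minimality leave no pointwise lower bound, only one in the
  mean with error \<open>\<tau> * energy \<mu>\<close>. This suffices: a probability measure living
  near \<open>E n\<close> where \<open>p < 1 - \<epsilon>\<close> must have energy at least
  \<open>\<epsilon> / \<tau>\<close>, so that region has capacity at most
  \<open>\<tau> / \<epsilon>\<close>. With tolerances that sum to \<epsilon>, countable
  subadditivity disposes of all exceptional sets at once, and a telescoping sum compares every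
  polynomial with the first. The factor \<open>(1 - 3 * \<epsilon>)\<^sup>2\<close> disappears as
  \<epsilon> tends to 0.\<close>

text \<open>
  Monomials are indexed by words instead of multi-indices, so that no multinomial coefficients
  occur in the expansion of the powers of the inner product.
\<close>

definition word_monomial :: "'d list \<Rightarrow> complex ^ 'd \<Rightarrow> complex" where
  "word_monomial l z = (\<Prod>i\<leftarrow>l. z $ i)"

lemma word_monomial_simps [simp]:
  "word_monomial [] z = 1" "word_monomial (i # l) z = z $ i * word_monomial l z"
  by (simp_all add: word_monomial_def)

definition words :: "nat \<Rightarrow> 'd list set" where
  "words n = {l. length l = n}"

lemma finite_words [simp]: "finite (words n :: 'd::finite list set)"
  using finite_lists_length_eq[of "UNIV :: 'd set" n] by (simp add: words_def)

lemma words_0 [simp]: "words 0 = {[]}"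
  by (simp add: words_def)

lemma words_Suc: "words (Suc n) = (\<lambda>(i, l). i # l) ` (UNIV \<times> words n)"
  by (auto simp: words_def length_Suc_conv)

lemma cinner_power:
  "cinner z w ^ n = (\<Sum>l\<in>words n. word_monomial l z * cnj (word_monomial l w))"
proof (induction n)
  case 0
  then show ?case by simp
next
  case (Suc n)
  have "inj_on (\<lambda>(i, l). i # l) (UNIV \<times> words n)" by (auto simp: inj_on_def)
  then have "(\<Sum>l\<in>words (Suc n). word_monomial l z * cnj (word_monomial l w)) =
      (\<Sum>(i, l)\<in>UNIV \<times> words n. (z $ i * cnj (w $ i)) * (word_monomial l z * cnj (word_monomial l w)))"
    unfolding words_Suc by (subst sum.reindex) (auto simp: case_prod_unfold algebra_simps intro!: sum.cong)
  also have "\<dots> = cinner z w * cinner z w ^ n"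
    unfolding Suc by (subst cinner_def) (simp add: sum_product sum.cartesian_product)
  finally show ?case by simp
qed

text \<open>A real feature map for the kernel: the product of a complex number with the conjugate of
  another has as real part the sum of the products of real parts and of imaginary parts. The weight
  \<open>sqrt 2\<close> produces the factor 2 of the kernel; the empty word has weight 1 because the
  constant term of the kernel is 2 - 1.\<close>

definition feature :: "'d list \<times> bool \<Rightarrow> complex ^ 'd \<Rightarrow> real" where
  "feature j z = (if fst j = [] then 1 else sqrt 2) *
     (if snd j then Re (word_monomial (fst j) z) else Im (word_monomial (fst j) z))"

definition level :: "nat \<Rightarrow> ('d list \<times> bool) set" where
  "level n = words n \<times> UNIV"

lemma finite_level [simp]: "finite (level n :: ('d::finite list \<times> bool) set)"
  by (simp add: level_def)

lemma level_disjoint: "m \<noteq> n \<Longrightarrow> level m \<inter> level n = {}"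
  by (auto simp: level_def words_def)

lemma sum_feature_level:
  fixes z w :: "complex ^ 'd"
  shows "(\<Sum>j\<in>level n. feature j z * feature j w) = (if n = 0 then 1 else 2) * Re (cinner z w ^ n)"
proof -
  have eq: "feature (l, True) z * feature (l, True) w + feature (l, False) z * feature (l, False) w =
      (if n = 0 then 1 else 2) * Re (word_monomial l z * cnj (word_monomial l w))" if "l \<in> words n" for l
    using that by (cases n) (auto simp: feature_def words_def algebra_simps)
  have "(\<Sum>j\<in>level n. feature j z * feature j w) =
      (\<Sum>l\<in>words n. \<Sum>b\<in>UNIV. feature (l, b) z * feature (l, b) w)"
    unfolding level_def by (simp add: sum.cartesian_product case_prod_unfold)
  also have "\<dots> = (\<Sum>l\<in>words n. (if n = 0 then 1 else 2) * Re (word_monomial l z * cnj (word_monomial l w)))"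
  proof (intro sum.cong refl)
    fix l :: "'d list" assume "l \<in> words n"
    have "(\<Sum>b\<in>UNIV. feature (l, b) z * feature (l, b) w) =
        feature (l, True) z * feature (l, True) w + feature (l, False) z * feature (l, False) w"
      by (simp add: UNIV_bool)
    then show "(\<Sum>b\<in>UNIV. feature (l, b) z * feature (l, b) w) =
        (if n = 0 then 1 else 2) * Re (word_monomial l z * cnj (word_monomial l w))"
      using eq[OF \<open>l \<in> words n\<close>] by simp
  qed
  finally show ?thesis
    unfolding cinner_power Re_sum sum_distrib_left[symmetric] .
qed

lemma norm_cinner_le_1:
  assumes "z \<in> sphere 0 1" "w \<in> sphere 0 1"
  shows "norm (cinner z w) \<le> 1"
  using norm_cinner_le[of z w] assms by simp

lemma abs_sum_feature_level_le:
  assumes "z \<in> sphere 0 1" "w \<in> sphere 0 1"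
  shows "\<bar>\<Sum>j\<in>level n. feature j z * feature j w\<bar> \<le> 2"
proof -
  have "\<bar>Re (cinner z w ^ n)\<bar> \<le> norm (cinner z w ^ n)" by (rule abs_Re_le_cmod)
  also have "\<dots> \<le> 1" using norm_cinner_le_1[OF assms] by (simp add: norm_power power_le_one)
  finally show ?thesis unfolding sum_feature_level by auto
qed

lemma cinner_scaleR:
  fixes z w :: "complex ^ 'd"
  shows "cinner (r *\<^sub>R z) (r *\<^sub>R w) = of_real (r\<^sup>2) * cinner z w"
proof -
  have "(r *\<^sub>R v) $ i = complex_of_real r * v $ i" for v :: "complex ^ 'd" and i
    by (metis scaleR_conv_of_real vector_scaleR_component)
  then show ?thesis
    unfolding cinner_def sum_distrib_left
    by (intro sum.cong refl) (simp add: power2_eq_square)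
qed

text \<open>Geometric series in the inner product of the dilated points. Both arguments are dilated,
  hence the exponent \<open>2 * n\<close>; the subtracted 1 affects level 0 only.\<close>

lemma h2d_kernel_sums:
  assumes "z \<in> sphere 0 1" "w \<in> sphere 0 1" "0 \<le> r" "r < 1"
  shows "(\<lambda>n. r ^ (2 * n) * (\<Sum>j\<in>level n. feature j z * feature j w)) sums
    h2d_kernel (r *\<^sub>R z) (r *\<^sub>R w)"
proof -
  define u where "u = cinner (r *\<^sub>R z) (r *\<^sub>R w)"
  have r2: "r\<^sup>2 < 1" using assms(3,4) by (simp add: power_less_one_iff)
  have "norm u = r\<^sup>2 * norm (cinner z w)"
    unfolding u_def cinner_scaleR norm_mult by (simp del: of_real_power)
  also have "\<dots> \<le> r\<^sup>2 * 1" by (intro mult_left_mono norm_cinner_le_1 assms) simp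
  finally have u: "norm u < 1" using r2 by simp
  have "(\<lambda>n. Re (u ^ n)) sums Re (1 / (1 - u))"
    using geometric_sums[OF u] by (rule sums_Re)
  then have "(\<lambda>n. 2 * Re (u ^ n) - (if n = 0 then 1 else 0)) sums (2 * Re (1 / (1 - u)) - 1)"
    by (intro sums_diff sums_mult sums_single[of 0 "\<lambda>_. 1"])
  moreover have "2 * Re (u ^ n) - (if n = 0 then 1 else 0) =
      r ^ (2 * n) * (\<Sum>j\<in>level n. feature j z * feature j w)" for n
  proof -
    have "Re (u ^ n) = r ^ (2 * n) * Re (cinner z w ^ n)"
      unfolding u_def cinner_scaleR power_mult_distrib of_real_power[symmetric] power_mult[symmetric]
      by (simp del: of_real_power)
    then show ?thesis unfolding sum_feature_level by auto
  qed
  ultimately show ?thesis unfolding h2d_kernel_def u_def by simp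
qed

lemma continuous_on_word_monomial [continuous_intros]: "continuous_on A (word_monomial l)"
proof (induction l)
  case Nil
  then show ?case by (simp add: word_monomial_def[abs_def])
next
  case (Cons i l)
  have "word_monomial (i # l) = (\<lambda>z. z $ i * word_monomial l z)" by auto
  then show ?case using Cons by (auto intro!: continuous_intros)
qed

lemma continuous_on_feature: "continuous_on A (feature j)"
  unfolding feature_def[abs_def]
  by (cases "snd j") (auto intro!: continuous_intros continuous_on_compose2[OF continuous_on_Re continuous_on_word_monomial])

lemma norm_word_monomial_le:
  assumes "z \<in> sphere 0 1"
  shows "norm (word_monomial l z) \<le> 1"
proof (induction l)
  case Nil
  then show ?case by simp
next
  case (Cons i l)
  have "norm (z $ i) \<le> 1" using assms Finite_Cartesian_Product.norm_nth_le[of z i] by simp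
  then show ?case using Cons by (simp add: norm_mult mult_le_one)
qed

lemma abs_feature_le:
  assumes "z \<in> sphere 0 1"
  shows "\<bar>feature j z\<bar> \<le> 2"
proof -
  define x where "x = (if snd j then Re (word_monomial (fst j) z) else Im (word_monomial (fst j) z))"
  have "\<bar>x\<bar> \<le> 1" unfolding x_def
    using norm_word_monomial_le[OF assms, of "fst j"] abs_Re_le_cmod abs_Im_le_cmod by (auto intro: order_trans)
  moreover have "\<bar>if fst j = [] then 1 else sqrt 2\<bar> \<le> 2"
    using real_sqrt_le_mono[of 2 4] by auto
  ultimately have "\<bar>if fst j = [] then 1 else sqrt 2\<bar> * \<bar>x\<bar> \<le> 2 * 1" by (intro mult_mono) auto
  then show ?thesis by (simp add: feature_def x_def abs_mult)
qed

text \<open>The total mass is left free because restrictions of probability measures to Borel pieces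
  also have energies, and these are compared below.\<close>

locale sphere_measure = finite_measure M for M :: "(complex ^ 'd) measure" +
  assumes sets_M: "sets M = sets (restrict_space borel (sphere 0 1))"
begin

lemma space_M: "space M = sphere 0 1"
  using sets_eq_imp_space_eq[OF sets_M] by (simp add: space_restrict_space)

lemma measurable_borel: "f \<in> borel_measurable borel \<Longrightarrow> f \<in> borel_measurable M"
  using measurable_restrict_space1 measurable_cong_sets[OF sets_M refl] by blast

lemma feature_measurable [measurable]: "feature j \<in> borel_measurable M"
  by (intro measurable_borel borel_measurable_continuous_onI continuous_on_feature)

lemma feature_integrable [simp]: "integrable M (feature j)"
  by (rule integrable_const_bound[of _ 2]) (auto simp: space_M abs_feature_le[simplified])

end

definition moment :: "(complex ^ 'd) measure \<Rightarrow> 'd list \<times> bool \<Rightarrow> real" where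
  "moment M j = (\<integral>z. feature j z \<partial>M)"

definition level_energy :: "(complex ^ 'd) measure \<Rightarrow> nat \<Rightarrow> real" where
  "level_energy M n = (\<Sum>j\<in>level n. (moment M j)\<^sup>2)"

lemma level_energy_nonneg [simp]: "0 \<le> level_energy M n"
  by (simp add: level_energy_def sum_nonneg)

definition dilated_energy :: "(complex ^ 'd) measure \<Rightarrow> real \<Rightarrow> real" where
  "dilated_energy M r = (LINT z|M. LINT w|M. h2d_kernel (r *\<^sub>R z) (r *\<^sub>R w))"

context sphere_measure
begin

lemma dilated_potential:
  assumes z: "z \<in> sphere 0 1" and r: "0 \<le> r" "r < 1"
  shows "integrable M (\<lambda>w. h2d_kernel (r *\<^sub>R z) (r *\<^sub>R w))"
    and "(\<lambda>n. r ^ (2 * n) * (\<Sum>j\<in>level n. feature j z * moment M j)) sums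
      (LINT w|M. h2d_kernel (r *\<^sub>R z) (r *\<^sub>R w))"
proof -
  define f where "f n w = r ^ (2 * n) * (\<Sum>j\<in>level n. feature j z * feature j w)" for n w
  have int: "integrable M (f n)" for n unfolding f_def by auto
  have bd: "norm (f n w) \<le> 2 * r ^ (2 * n)" if "w \<in> sphere 0 1" for n w
    using mult_left_mono[OF abs_sum_feature_level_le[OF z that, of n], of "r ^ (2 * n)"] r
    by (simp add: f_def abs_mult power_mult mult.commute)
  have "r\<^sup>2 < 1" using r by (simp add: power_less_one_iff)
  then have g: "summable (\<lambda>n. 2 * r ^ (2 * n) * c)" for c
    by (intro summable_mult2 summable_mult) (simp add: power_mult summable_geometric)
  have s1: "AE w in M. summable (\<lambda>n. norm (f n w))"
  proof (rule AE_I2)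
    fix w assume "w \<in> space M"
    then show "summable (\<lambda>n. norm (f n w))"
      using bd by (intro summable_comparison_test'[OF g[of 1], of 0]) (simp add: space_M)
  qed
  have s2: "summable (\<lambda>n. \<integral>w. norm (f n w) \<partial>M)"
  proof (rule summable_comparison_test'[OF g[of "measure M (space M)"], of 0])
    fix n
    have "(\<integral>w. norm (f n w) \<partial>M) \<le> (\<integral>w. 2 * r ^ (2 * n) \<partial>M)"
      using bd int[of n] by (intro integral_mono) (auto simp: space_M)
    then show "norm (\<integral>w. norm (f n w) \<partial>M) \<le> 2 * r ^ (2 * n) * measure M (space M)"
      by (simp add: ac_simps)
  qed
  have k: "(\<Sum>n. f n w) = h2d_kernel (r *\<^sub>R z) (r *\<^sub>R w)" if "w \<in> space M" for w
    using sums_unique[OF h2d_kernel_sums[OF z _ r, of w]] that by (simp add: space_M f_def)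
  show "integrable M (\<lambda>w. h2d_kernel (r *\<^sub>R z) (r *\<^sub>R w))"
    using integrable_suminf[OF int s1 s2] by (subst Bochner_Integration.integrable_cong[OF refl k, symmetric])
  have "(\<lambda>n. integral\<^sup>L M (f n)) sums (\<integral>w. (\<Sum>n. f n w) \<partial>M)"
    by (rule sums_integral[OF int s1 s2])
  moreover have "integral\<^sup>L M (f n) = r ^ (2 * n) * (\<Sum>j\<in>level n. feature j z * moment M j)" for n
    unfolding f_def moment_def by simp
  moreover have "(\<integral>w. (\<Sum>n. f n w) \<partial>M) = (LINT w|M. h2d_kernel (r *\<^sub>R z) (r *\<^sub>R w))"
    by (rule Bochner_Integration.integral_cong[OF refl k])
  ultimately show "(\<lambda>n. r ^ (2 * n) * (\<Sum>j\<in>level n. feature j z * moment M j)) sums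
      (LINT w|M. h2d_kernel (r *\<^sub>R z) (r *\<^sub>R w))" by simp
qed


text \<open>Termwise integration, dominated by a geometric series. The second form, with nonnegative
  integrals, later allows integrands to be compared under restriction of the measure without
  integrability conditions.\<close>

lemma dilated_energy_sums:
  assumes r: "0 \<le> r" "r < 1"
  shows "(\<lambda>n. r ^ (2 * n) * level_energy M n) sums dilated_energy M r"
    and "ennreal (dilated_energy M r) =
      (\<integral>\<^sup>+z. \<integral>\<^sup>+w. ennreal (h2d_kernel (r *\<^sub>R z) (r *\<^sub>R w)) \<partial>M \<partial>M)"
proof -
  define f where "f n z = r ^ (2 * n) * (\<Sum>j\<in>level n. feature j z * moment M j)" for n z
  have int: "integrable M (f n)" for n unfolding f_def by auto
  have f_int: "f n z = (\<integral>w. r ^ (2 * n) * (\<Sum>j\<in>level n. feature j z * feature j w) \<partial>M)" for n z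
    unfolding f_def moment_def by simp
  have bd: "norm (f n z) \<le> 2 * r ^ (2 * n) * measure M (space M)" if z: "z \<in> sphere 0 1" for n z
  proof -
    have "norm (r ^ (2 * n) * (\<Sum>j\<in>level n. feature j z * feature j w)) \<le> 2 * r ^ (2 * n)"
      if "w \<in> sphere 0 1" for w
      using mult_left_mono[OF abs_sum_feature_level_le[OF z that, of n], of "r ^ (2 * n)"] r
      by (simp add: abs_mult power_mult mult.commute)
    then have "norm (f n z) \<le> (\<integral>w. 2 * r ^ (2 * n) \<partial>M)" unfolding f_int
      by (intro order_trans[OF integral_norm_bound] integral_mono) (auto simp: space_M)
    then show ?thesis by (simp add: ac_simps)
  qed
  have "r\<^sup>2 < 1" using r by (simp add: power_less_one_iff)
  then have g: "summable (\<lambda>n. 2 * r ^ (2 * n) * c)" for c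
    by (intro summable_mult2 summable_mult) (simp add: power_mult summable_geometric)
  have s1: "AE z in M. summable (\<lambda>n. norm (f n z))"
  proof (rule AE_I2)
    fix z assume "z \<in> space M"
    then show "summable (\<lambda>n. norm (f n z))"
      using bd by (intro summable_comparison_test'[OF g, of 0]) (simp add: space_M)
  qed
  have s2: "summable (\<lambda>n. \<integral>z. norm (f n z) \<partial>M)"
  proof (rule summable_comparison_test'[OF g, of 0])
    fix n
    have "(\<integral>z. norm (f n z) \<partial>M) \<le> (\<integral>z. 2 * r ^ (2 * n) * measure M (space M) \<partial>M)"
      using bd int[of n] by (intro integral_mono) (auto simp: space_M)
    then show "norm (\<integral>z. norm (f n z) \<partial>M) \<le> 2 * r ^ (2 * n) * (measure M (space M) * measure M (space M))"
      by (simp add: ac_simps)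
  qed
  have k: "(\<Sum>n. f n z) = (LINT w|M. h2d_kernel (r *\<^sub>R z) (r *\<^sub>R w))" if "z \<in> space M" for z
    using sums_unique[OF dilated_potential(2)[OF _ r, of z]] that by (simp add: space_M f_def)
  have int_k: "integrable M (\<lambda>z. LINT w|M. h2d_kernel (r *\<^sub>R z) (r *\<^sub>R w))"
    using integrable_suminf[OF int s1 s2] by (subst Bochner_Integration.integrable_cong[OF refl k, symmetric])
  have "(\<lambda>n. integral\<^sup>L M (f n)) sums (\<integral>z. (\<Sum>n. f n z) \<partial>M)"
    by (rule sums_integral[OF int s1 s2])
  moreover have "integral\<^sup>L M (f n) = r ^ (2 * n) * level_energy M n" for n
    unfolding f_def level_energy_def by (simp add: moment_def power2_eq_square)
  moreover have "(\<integral>z. (\<Sum>n. f n z) \<partial>M) = dilated_energy M r"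
    unfolding dilated_energy_def by (rule Bochner_Integration.integral_cong[OF refl k])
  ultimately show "(\<lambda>n. r ^ (2 * n) * level_energy M n) sums dilated_energy M r" by simp
  have ball: "r *\<^sub>R z \<in> ball 0 1" if "z \<in> space M" for z using that r by (simp add: space_M)
  have pos: "0 \<le> h2d_kernel (r *\<^sub>R z) (r *\<^sub>R w)" if "z \<in> space M" "w \<in> space M" for z w
    using h2d_kernel_pos[OF ball ball, OF that] by simp
  have "ennreal (dilated_energy M r) = (\<integral>\<^sup>+z. ennreal (LINT w|M. h2d_kernel (r *\<^sub>R z) (r *\<^sub>R w)) \<partial>M)"
    unfolding dilated_energy_def using pos
    by (intro nn_integral_eq_integral[symmetric] int_k AE_I2 integral_nonneg_AE) auto
  also have "\<dots> = (\<integral>\<^sup>+z. \<integral>\<^sup>+w. ennreal (h2d_kernel (r *\<^sub>R z) (r *\<^sub>R w)) \<partial>M \<partial>M)"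
    using pos dilated_potential(1)[OF _ r]
    by (intro nn_integral_cong nn_integral_eq_integral[symmetric] AE_I2) (auto simp: space_M)
  finally show "ennreal (dilated_energy M r) =
      (\<integral>\<^sup>+z. \<integral>\<^sup>+w. ennreal (h2d_kernel (r *\<^sub>R z) (r *\<^sub>R w)) \<partial>M \<partial>M)" .
qed

text \<open>Monotone convergence as r tends to 1: the factors \<open>r ^ (2 * n)\<close> are at most
  1, and each finite partial sum is recovered in the limit. From here on the kernel need not be
  evaluated on the boundary; the energy is the squared length of the moment sequence.\<close>

lemma h2d_energy_eq_suminf: "h2d_energy M = (\<Sum>n. ennreal (level_energy M n))"
proof (rule antisym)
  have "ennreal (dilated_energy M r) \<le> (\<Sum>n. ennreal (level_energy M n))" if r: "0 \<le> r" "r < 1" for r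
  proof -
    have "ennreal (dilated_energy M r) = (\<Sum>n. ennreal (r ^ (2 * n) * level_energy M n))"
      unfolding sums_unique[OF dilated_energy_sums(1)[OF r]]
      using r sums_summable[OF dilated_energy_sums(1)[OF r]] by (intro suminf_ennreal2[symmetric]) auto
    also have "\<dots> \<le> (\<Sum>n. ennreal (level_energy M n))"
      using r by (intro suminf_le ennreal_leI mult_left_le_one_le) (auto simp: power_le_one)
    finally show ?thesis .
  qed
  then show "h2d_energy M \<le> (\<Sum>n. ennreal (level_energy M n))"
    unfolding h2d_energy_def dilated_energy_def[symmetric] by (intro SUP_least) auto
  show "(\<Sum>n. ennreal (level_energy M n)) \<le> h2d_energy M"
  proof (rule suminf_le_const)
    fix N
    have "(\<lambda>r. ennreal (\<Sum>n<N. r ^ (2 * n) * level_energy M n)) \<midarrow>1\<rightarrow> ennreal (\<Sum>n<N. 1 ^ (2 * n) * level_energy M n)"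
      by (intro tendsto_intros)
    then have "((\<lambda>r. ennreal (\<Sum>n<N. r ^ (2 * n) * level_energy M n)) \<longlongrightarrow> (\<Sum>n<N. ennreal (level_energy M n))) (at_left 1)"
      by (simp add: sum_ennreal filterlim_at_split)
    then show "(\<Sum>n<N. ennreal (level_energy M n)) \<le> h2d_energy M"
    proof (rule tendsto_upperbound)
      have "ennreal (\<Sum>n<N. r ^ (2 * n) * level_energy M n) \<le> h2d_energy M" if r: "0 \<le> r" "r < 1" for r
      proof -
        have "(\<Sum>n<N. r ^ (2 * n) * level_energy M n) \<le> dilated_energy M r"
          unfolding sums_unique[OF dilated_energy_sums(1)[OF r]]
          using r sums_summable[OF dilated_energy_sums(1)[OF r]] by (intro sum_le_suminf) auto
        then have "ennreal (\<Sum>n<N. r ^ (2 * n) * level_energy M n) \<le> ennreal (dilated_energy M r)"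
          by (rule ennreal_leI)
        also have "\<dots> \<le> h2d_energy M"
          unfolding h2d_energy_def dilated_energy_def[symmetric] using r by (intro SUP_upper) auto
        finally show ?thesis .
      qed
      moreover have "\<forall>\<^sub>F r in at_left (1::real). 0 < r \<and> r < 1"
        using eventually_at_left_real[of 0 "1::real"] by simp
      ultimately show "\<forall>\<^sub>F r in at_left 1. ennreal (\<Sum>n<N. r ^ (2 * n) * level_energy M n) \<le> h2d_energy M"
        by (auto elim!: eventually_mono)
    qed simp
  qed simp
qed

end

subsection \<open>Capacity of Borel sets\<close>

text \<open>
  For a set \<open>B\<close> that is not Borel the condition may hold vacuously, since \<^const>\<open>emeasure\<close> vanishes
  on non-measurable sets.
\<close>

abbreviation concentrated_on :: "(complex ^ 'd) measure \<Rightarrow> (complex ^ 'd) set \<Rightarrow> bool" where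
  "concentrated_on M B \<equiv> emeasure M (sphere 0 1 - B) = 0"

text \<open>\<open>enn2real\<close> sends \<open>\<top>\<close> to 0, so this number is meaningful
  only for finite energy, a hypothesis that is carried along.\<close>

abbreviation energy :: "(complex ^ 'd) measure \<Rightarrow> real" where
  "energy M \<equiv> enn2real (h2d_energy M)"

lemma sphere_prob_imp_sphere_measure: "sphere_prob M \<Longrightarrow> sphere_measure M"
  unfolding sphere_prob_def sphere_measure_def sphere_measure_axioms_def
  by (simp add: prob_space.finite_measure)

context sphere_measure
begin

lemma borel_Int_sets:
  assumes "B \<in> sets borel"
  shows "sphere 0 1 \<inter> B \<in> sets M" "sphere 0 1 - B \<in> sets M"
proof -
  have "sphere 0 1 \<inter> B \<in> sets (restrict_space borel (sphere 0 1))" if "B \<in> sets borel" for B :: "(complex ^ 'd) set"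
    using that by (auto simp: sets_restrict_space)
  from this[OF assms] this[of "- B"] assms show "sphere 0 1 \<inter> B \<in> sets M" "sphere 0 1 - B \<in> sets M"
    by (simp_all add: sets_M Diff_eq)
qed

lemma indicator_measurable_ennreal: "B \<in> sets borel \<Longrightarrow> (indicator B :: _ \<Rightarrow> ennreal) \<in> borel_measurable M"
  by (intro measurable_borel) auto

lemma dilated_energy_mono:
  assumes "0 \<le> r" "r \<le> s" "s < 1"
  shows "dilated_energy M r \<le> dilated_energy M s"
proof (rule sums_le)
  show "(\<lambda>n. r ^ (2 * n) * level_energy M n) sums dilated_energy M r"
    "(\<lambda>n. s ^ (2 * n) * level_energy M n) sums dilated_energy M s"
    using assms by (auto intro!: dilated_energy_sums)
qed (use assms in \<open>auto intro!: mult_right_mono power_mono\<close>)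

text \<open>Monotonicity in r turns the defining supremum into a limit, and limits pass through the
  finite sums of energies in the next estimate.\<close>

lemma dilated_energy_tendsto:
  "((\<lambda>r. ennreal (dilated_energy M r)) \<longlongrightarrow> h2d_energy M) (at_left 1)"
proof (rule order_tendstoI)
  have E: "h2d_energy M = (SUP r\<in>{0..<1}. ennreal (dilated_energy M r))"
    unfolding h2d_energy_def dilated_energy_def ..
  fix a
  {
    assume "a < h2d_energy M"
    then obtain s where s: "0 \<le> s" "s < 1" "a < ennreal (dilated_energy M s)"
      unfolding E less_SUP_iff by auto
    have "\<forall>\<^sub>F r in at_left 1. s < r \<and> r < 1"
      using eventually_at_left_real[of s 1] s by simp
    then show "\<forall>\<^sub>F r in at_left 1. a < ennreal (dilated_energy M r)"
    proof eventually_elim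
      case (elim r)
      then have "ennreal (dilated_energy M s) \<le> ennreal (dilated_energy M r)"
        using s by (intro ennreal_leI dilated_energy_mono) auto
      with s(3) show ?case by (rule less_le_trans)
    qed
  }
  assume a: "h2d_energy M < a"
  have "\<forall>\<^sub>F r in at_left 1. 0 < r \<and> r < (1::real)"
    using eventually_at_left_real[of 0 "1::real"] by simp
  then show "\<forall>\<^sub>F r in at_left 1. ennreal (dilated_energy M r) < a"
  proof eventually_elim
    case (elim r)
    then have "ennreal (dilated_energy M r) \<le> h2d_energy M" unfolding E by (intro SUP_upper) auto
    with a show ?case by simp
  qed
qed

lemma finite_energy:
  assumes "h2d_energy M \<noteq> \<top>"
  shows "summable (level_energy M)" "energy M = (\<Sum>n. level_energy M n)"
    "h2d_energy M = ennreal (energy M)" "0 \<le> energy M"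
proof -
  show "summable (level_energy M)"
    using assms unfolding h2d_energy_eq_suminf by (intro summable_suminf_not_top) auto
  then show "energy M = (\<Sum>n. level_energy M n)"
    using assms unfolding h2d_energy_eq_suminf by (subst suminf_ennreal2) (auto intro!: enn2real_ennreal suminf_nonneg)
qed (use assms in \<open>simp_all add: less_top\<close>)

text \<open>Positivity of the kernel enters here: discarding cross terms lowers the energy.\<close>

lemma sum_energy_restrict_le:
  assumes B: "\<And>i. i \<in> I \<Longrightarrow> B i \<in> sets borel" "disjoint_family_on B I" "finite I"
  shows "(\<Sum>i\<in>I. h2d_energy (density M (indicator (B i)))) \<le> h2d_energy M"
    and "i \<in> I \<Longrightarrow> sphere_measure (density M (indicator (B i)))"
proof -
  show sm: "sphere_measure (density M (indicator (B i)))" if "i \<in> I" for i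
    unfolding sphere_measure_def sphere_measure_axioms_def
  proof
    show "finite_measure (density M (indicator (B i)))"
    proof
      have "(\<integral>\<^sup>+z. indicator (B i) z * indicator (space M) z \<partial>M) \<le> (\<integral>\<^sup>+z. indicator (space M) z \<partial>M)"
        by (intro nn_integral_mono) (auto simp: indicator_def)
      then have "emeasure (density M (indicator (B i))) (space M) \<le> emeasure M (space M)"
        by (subst emeasure_density[OF indicator_measurable_ennreal[OF B(1)[OF that]]]) simp_all
      then show "emeasure (density M (indicator (B i))) (space (density M (indicator (B i)))) \<noteq> \<infinity>"
        using emeasure_finite[of "space M"] by (metis neq_top_trans infinity_ennreal_def space_density)
    qed
  qed (simp add: sets_M)
  have le: "(\<Sum>i\<in>I. ennreal (dilated_energy (density M (indicator (B i))) r)) \<le> ennreal (dilated_energy M r)"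
    if r: "0 \<le> r" "r < 1" for r
  proof -
    define k where "k z w = ennreal (h2d_kernel (r *\<^sub>R z) (r *\<^sub>R w))" for z w :: "complex ^ 'd"
    have km: "k z \<in> borel_measurable M" if "z \<in> space M" for z
      using borel_measurable_integrable[OF dilated_potential(1)[of z r]] r that
      unfolding k_def by (auto simp: space_M)
    have "ennreal (dilated_energy (density M (indicator (B i))) r) =
        (\<integral>\<^sup>+z. indicator (B i) z * (\<integral>\<^sup>+w. indicator (B i) w * k z w \<partial>M) \<partial>M)" 
      and mi: "(\<lambda>z. indicator (B i) z * (\<integral>\<^sup>+w. indicator (B i) w * k z w \<partial>M)) \<in> borel_measurable M" if "i \<in> I" for i
    proof -
      interpret D: sphere_measure "density M (indicator (B i))" by (rule sm[OF that])
      have im: "(indicator (B i) :: _ \<Rightarrow> ennreal) \<in> borel_measurable M" 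
        by (rule indicator_measurable_ennreal[OF B(1)[OF that]])
      have inner: "(\<integral>\<^sup>+w. k z w \<partial>density M (indicator (B i))) = (\<integral>\<^sup>+w. indicator (B i) w * k z w \<partial>M)"
        if "z \<in> space M" for z
        by (rule nn_integral_density[OF im km[OF that]])
      \<comment> \<open>The inner integral is measurable in \<open>z\<close> because it is a series
        in the features; joint measurability of the kernel is thereby avoided.\<close>
      have m: "(\<lambda>z. \<integral>\<^sup>+w. indicator (B i) w * k z w \<partial>M) \<in> borel_measurable M"
      proof -
        have "(\<lambda>z. ennreal (\<Sum>n. r ^ (2 * n) * (\<Sum>j\<in>level n. feature j z * moment (density M (indicator (B i))) j))) \<in> borel_measurable M"
          by measurable
        moreover have "(\<integral>\<^sup>+w. indicator (B i) w * k z w \<partial>M) =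
            ennreal (\<Sum>n. r ^ (2 * n) * (\<Sum>j\<in>level n. feature j z * moment (density M (indicator (B i))) j))"
          if z: "z \<in> space M" for z
        proof -
          have ball: "r *\<^sub>R w \<in> ball 0 1" if "w \<in> space M" for w
            using r that by (simp add: space_M)
          have pos: "0 \<le> h2d_kernel (r *\<^sub>R z) (r *\<^sub>R w)" if "w \<in> space M" for w
            using h2d_kernel_pos[OF ball[OF z] ball[OF that]] by simp
          have "(\<integral>\<^sup>+w. indicator (B i) w * k z w \<partial>M) = (\<integral>\<^sup>+w. k z w \<partial>density M (indicator (B i)))"
            by (rule inner[OF z, symmetric])
          also have "\<dots> = ennreal (LINT w|density M (indicator (B i)). h2d_kernel (r *\<^sub>R z) (r *\<^sub>R w))"
            unfolding k_def using z r pos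
            by (intro nn_integral_eq_integral D.dilated_potential AE_I2) (auto simp: space_M)
          also have "(LINT w|density M (indicator (B i)). h2d_kernel (r *\<^sub>R z) (r *\<^sub>R w)) =
              (\<Sum>n. r ^ (2 * n) * (\<Sum>j\<in>level n. feature j z * moment (density M (indicator (B i))) j))"
            using z r by (intro sums_unique D.dilated_potential(2)) (auto simp: space_M)
          finally show ?thesis .
        qed
        ultimately show ?thesis by (simp cong: measurable_cong)
      qed
      have "ennreal (dilated_energy (density M (indicator (B i))) r) =
        (\<integral>\<^sup>+z. \<integral>\<^sup>+w. k z w \<partial>density M (indicator (B i)) \<partial>density M (indicator (B i)))"
        unfolding k_def by (rule D.dilated_energy_sums(2)[OF r])
      also have "\<dots> = (\<integral>\<^sup>+z. \<integral>\<^sup>+w. indicator (B i) w * k z w \<partial>M \<partial>density M (indicator (B i)))"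
        by (intro nn_integral_cong) (simp add: inner)
      also have "\<dots> = (\<integral>\<^sup>+z. indicator (B i) z * (\<integral>\<^sup>+w. indicator (B i) w * k z w \<partial>M) \<partial>M)"
        by (rule nn_integral_density[OF im m])
      finally show "ennreal (dilated_energy (density M (indicator (B i))) r) =
        (\<integral>\<^sup>+z. indicator (B i) z * (\<integral>\<^sup>+w. indicator (B i) w * k z w \<partial>M) \<partial>M)" .
      show "(\<lambda>z. indicator (B i) z * (\<integral>\<^sup>+w. indicator (B i) w * k z w \<partial>M)) \<in> borel_measurable M"
        using im m by (rule borel_measurable_times_ennreal)
    qed
    then have "(\<Sum>i\<in>I. ennreal (dilated_energy (density M (indicator (B i))) r)) =
        (\<integral>\<^sup>+z. (\<Sum>i\<in>I. indicator (B i) z * (\<integral>\<^sup>+w. indicator (B i) w * k z w \<partial>M)) \<partial>M)"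
      by (subst nn_integral_sum) simp_all
    also have "\<dots> \<le> (\<integral>\<^sup>+z. (\<integral>\<^sup>+w. k z w \<partial>M) \<partial>M)"
    proof (rule nn_integral_mono)
      fix z
      \<comment> \<open>Enlarging the inner integral to all of \<open>M\<close> adds back the cross
        terms; disjointness then leaves at most one outer indicator equal to 1.\<close>
      have "(\<Sum>i\<in>I. indicator (B i) z * (\<integral>\<^sup>+w. indicator (B i) w * k z w \<partial>M)) \<le>
          (\<Sum>i\<in>I. indicator (B i) z * (\<integral>\<^sup>+w. k z w \<partial>M))"
        by (intro sum_mono mult_left_mono nn_integral_mono) (auto simp: indicator_def)
      also have "\<dots> = (\<Sum>i\<in>I. indicator (B i) z) * (\<integral>\<^sup>+w. k z w \<partial>M)"
        by (simp add: sum_distrib_right)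
      also have "(\<Sum>i\<in>I. indicator (B i) z) = (indicator (\<Union>i\<in>I. B i) z :: ennreal)"
        by (rule indicator_UN_disjoint[OF B(3,2), symmetric])
      also have "indicator (\<Union>i\<in>I. B i) z * (\<integral>\<^sup>+w. k z w \<partial>M) \<le> (\<integral>\<^sup>+w. k z w \<partial>M)"
        by (auto simp: indicator_def)
      finally show "(\<Sum>i\<in>I. indicator (B i) z * (\<integral>\<^sup>+w. indicator (B i) w * k z w \<partial>M)) \<le> (\<integral>\<^sup>+w. k z w \<partial>M)" .
    qed
    also have "\<dots> = ennreal (dilated_energy M r)"
      unfolding k_def by (rule dilated_energy_sums(2)[OF r, symmetric])
    finally show ?thesis .
  qed
  show "(\<Sum>i\<in>I. h2d_energy (density M (indicator (B i)))) \<le> h2d_energy M"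
  proof (rule tendsto_le)
    show "((\<lambda>r. \<Sum>i\<in>I. ennreal (dilated_energy (density M (indicator (B i))) r)) \<longlongrightarrow>
        (\<Sum>i\<in>I. h2d_energy (density M (indicator (B i))))) (at_left 1)"
      by (intro tendsto_sum sphere_measure.dilated_energy_tendsto sm)
    show "((\<lambda>r. ennreal (dilated_energy M r)) \<longlongrightarrow> h2d_energy M) (at_left 1)"
      by (rule dilated_energy_tendsto)
    have "\<forall>\<^sub>F r in at_left 1. 0 < r \<and> r < (1::real)"
      using eventually_at_left_real[of 0 "1::real"] by simp
    then show "\<forall>\<^sub>F r in at_left 1. (\<Sum>i\<in>I. ennreal (dilated_energy (density M (indicator (B i))) r))
        \<le> ennreal (dilated_energy M r)"
      by eventually_elim (simp add: le)
  qed simp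
qed

end

text \<open>Level 0 of the energy is the squared total mass.\<close>

lemma energy_ge_1:
  assumes "sphere_prob M" "h2d_energy M \<noteq> \<top>"
  shows "1 \<le> energy M"
proof -
  interpret sphere_measure M by (rule sphere_prob_imp_sphere_measure) fact
  interpret prob_space M using assms(1) by (simp add: sphere_prob_def)
  have "1 = level_energy M 0"
    by (simp add: level_energy_def level_def moment_def feature_def UNIV_bool prob_space)
  also have "\<dots> \<le> (\<Sum>n. level_energy M n)"
    using sum_le_suminf[OF finite_energy(1)[OF assms(2)], of "{0}"] by simp
  finally show ?thesis using finite_energy(2)[OF assms(2)] by simp
qed

lemma one_divide_h2d_energy:
  assumes "sphere_prob M" "h2d_energy M \<noteq> \<top>"
  shows "1 / h2d_energy M = ennreal (1 / energy M)"
proof -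
  have "1 / h2d_energy M = ennreal 1 / ennreal (energy M)"
    using assms(2) by (simp add: less_top)
  also have "\<dots> = ennreal (1 / energy M)"
    using energy_ge_1[OF assms] by (intro divide_ennreal) auto
  finally show ?thesis .
qed

text \<open>The product form avoids division in \<open>ennreal\<close>; measures of infinite energy
  contribute 0 to the supremum. Since \<open>cap_compact\<close> is defined for all sets, this and
  its converse serve for Borel sets as well.\<close>

lemma cap_compact_leI:
  assumes "0 \<le> c"
    and "\<And>M. \<lbrakk>sphere_prob M; concentrated_on M B; h2d_energy M \<noteq> \<top>\<rbrakk> \<Longrightarrow> 1 \<le> c * energy M"
  shows "cap_compact B \<le> ennreal c"
  unfolding cap_compact_def
proof (rule SUP_least, clarify)
  fix M assume M: "sphere_prob M" "concentrated_on M B"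
  show "1 / h2d_energy M \<le> ennreal c"
  proof (cases "h2d_energy M = \<top>")
    case False
    have e: "1 \<le> energy M" by (rule energy_ge_1[OF M(1) False])
    have "1 / h2d_energy M = ennreal (1 / energy M)" by (rule one_divide_h2d_energy[OF M(1) False])
    also have "\<dots> \<le> ennreal c"
      using assms(2)[OF M False] e by (intro ennreal_leI) (simp add: field_simps)
    finally show ?thesis .
  qed simp
qed

lemma cap_compactD:
  assumes M: "sphere_prob M" "concentrated_on M B" "h2d_energy M \<noteq> \<top>"
    and c: "cap_compact B \<le> ennreal c" "0 \<le> c"
  shows "1 \<le> c * energy M"
proof -
  have e: "1 \<le> energy M" by (rule energy_ge_1[OF M(1,3)])
  have "ennreal (1 / energy M) = 1 / h2d_energy M" by (rule one_divide_h2d_energy[OF M(1,3), symmetric])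
  also have "\<dots> \<le> cap_compact B"
    unfolding cap_compact_def using M by (intro SUP_upper) auto
  also note c(1)
  finally have "1 / energy M \<le> c" using c(2) by (simp add: ennreal_le_iff)
  then show ?thesis using e by (simp add: field_simps)
qed

lemma cap_compact_le_1: "cap_compact B \<le> 1"
proof -
  have "cap_compact B \<le> ennreal 1" by (rule cap_compact_leI) (simp_all add: energy_ge_1)
  then show ?thesis by simp
qed

lemma cap_compact_mono:
  assumes "A \<subseteq> B" "A \<in> sets borel"
  shows "cap_compact A \<le> cap_compact B"
  unfolding cap_compact_def
proof (rule SUP_subset_mono, clarify)
  fix M assume M: "sphere_prob M" "concentrated_on M A"
  interpret sphere_measure M by (rule sphere_prob_imp_sphere_measure) fact
  have "emeasure M (sphere 0 1 - B) \<le> emeasure M (sphere 0 1 - A)"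
    using assms by (intro emeasure_mono borel_Int_sets) auto
  then show "concentrated_on M B" using M by simp
qed simp

context sphere_measure
begin

text \<open>Energy is quadratic in the measure, so normalising to mass 1 divides it by the squared
  mass. This is the homogeneous form of the capacity bound.\<close>

lemma measure_power2_le_energy:
  assumes B: "concentrated_on M B" and fin: "h2d_energy M \<noteq> \<top>"
    and c: "cap_compact B \<le> ennreal c" "0 \<le> c"
  shows "(measure M (space M))\<^sup>2 \<le> c * energy M"
proof (cases "measure M (space M) = 0")
  case True
  then show ?thesis using c finite_energy(4)[OF fin] by simp
next
  case False
  define b where "b = measure M (space M)"
  have b: "b > 0" using False measure_nonneg[of M "space M"] by (simp add: b_def less_le)
  define N where "N = density M (\<lambda>_. ennreal (1 / b))"
  have em: "emeasure N A = ennreal (1 / b) * emeasure M A" if "A \<in> sets M" for A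
    unfolding N_def by (rule emeasure_density_const[OF that])
  have "emeasure N (space N) = ennreal (1 / b) * ennreal b"
    using em[of "space M"] by (simp add: N_def emeasure_eq_measure b_def)
  also have "\<dots> = 1" using b by (simp flip: ennreal_mult')
  finally have "prob_space N" by (rule prob_spaceI)
  then have N: "sphere_prob N" by (simp add: sphere_prob_def N_def sets_M)
  interpret N: sphere_measure N by (rule sphere_prob_imp_sphere_measure[OF N])
  have "concentrated_on N B"
  proof (cases "sphere 0 1 - B \<in> sets M")
    case True
    then show ?thesis using B by (simp add: em)
  next
    case False
    then show ?thesis by (intro emeasure_notin_sets) (simp add: N_def)
  qed
  have mom: "moment N j = moment M j / b" for j
    unfolding moment_def N_def using b by (subst integral_density) simp_all
  have lev: "level_energy N n = level_energy M n / b\<^sup>2" for n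
    by (simp add: level_energy_def mom power_divide sum_divide_distrib)
  have sm: "summable (level_energy N)"
    unfolding lev[abs_def] by (intro summable_divide finite_energy fin)
  have finN: "h2d_energy N \<noteq> \<top>"
    unfolding N.h2d_energy_eq_suminf using sm by (subst suminf_ennreal2) auto
  have "energy N = energy M / b\<^sup>2"
    unfolding N.finite_energy(2)[OF finN] finite_energy(2)[OF fin] lev
    by (rule suminf_divide[OF finite_energy(1)[OF fin]])
  moreover have "1 \<le> c * energy N" by (rule cap_compactD) fact+
  ultimately show ?thesis using b by (simp add: b_def field_simps)
qed

text \<open>The homogeneous bound for a piece of \<open>M\<close>: the right-hand side contains the
  energy of the piece alone, and over disjoint pieces these energies add up to at most that of
  \<open>M\<close>.\<close>

lemma measure_restrict_power2_le:
  assumes B: "B \<in> sets borel" "D \<in> sets borel" "D \<subseteq> B"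
    and fin: "h2d_energy (density M (indicator D)) \<noteq> \<top>"
    and c: "cap_compact B \<le> ennreal c" "0 \<le> c"
  shows "(measure M (sphere 0 1 \<inter> D))\<^sup>2 \<le> c * energy (density M (indicator D))"
proof -
  interpret R: sphere_measure "density M (indicator D)"
    by (rule sum_energy_restrict_le(2)[of "{()}" "\<lambda>_. D" "()"]) (simp_all add: B(2) disjoint_family_on_def)
  have em: "emeasure (density M (indicator D)) A = emeasure M (D \<inter> A)" if "A \<in> sets M" for A
  proof -
    have "emeasure (density M (indicator D)) A = (\<integral>\<^sup>+z. indicator D z * indicator A z \<partial>M)"
      by (rule emeasure_density[OF indicator_measurable_ennreal[OF B(2)] that])
    also have "\<dots> = (\<integral>\<^sup>+z. indicator (sphere 0 1 \<inter> D \<inter> A) z \<partial>M)"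
      by (intro nn_integral_cong) (auto simp: indicator_def space_M)
    also have "\<dots> = emeasure M (sphere 0 1 \<inter> D \<inter> A)"
      using that borel_Int_sets(1)[OF B(2)] by (intro nn_integral_indicator) auto
    also have "sphere 0 1 \<inter> D \<inter> A = D \<inter> A"
      using sets.sets_into_space[OF that] by (auto simp: space_M)
    finally show ?thesis .
  qed
  have "emeasure (density M (indicator D)) (sphere 0 1 - B) = emeasure M (D \<inter> (sphere 0 1 - B))"
    by (rule em[OF borel_Int_sets(2)[OF B(1)]])
  also have "D \<inter> (sphere 0 1 - B) = {}" using B(3) by auto
  finally have "concentrated_on (density M (indicator D)) B" by simp
  from R.measure_power2_le_energy[OF this fin c]
  have "(measure (density M (indicator D)) (space M))\<^sup>2 \<le> c * energy (density M (indicator D))" by simp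
  also have "measure (density M (indicator D)) (space M) = measure M (sphere 0 1 \<inter> D)"
    using em[OF sets.top] by (simp add: measure_def space_M Int_commute)
  finally show ?thesis .
qed

lemma energy_restrict_le:
  assumes "D \<in> sets borel"
  shows "h2d_energy (density M (indicator D)) \<le> h2d_energy M"
  using sum_energy_restrict_le(1)[of "{()}" "\<lambda>_. D"] assms by (simp add: disjoint_family_on_def)

end

lemma sphere_prob_concentrated:
  assumes M: "sphere_prob M" and B: "B \<in> sets borel" "concentrated_on M B"
  shows "measure M (sphere 0 1 \<inter> B) = 1"
proof -
  interpret sphere_measure M by (rule sphere_prob_imp_sphere_measure) fact
  interpret prob_space M using M by (simp add: sphere_prob_def)
  have "sphere 0 1 \<inter> B = space M - (sphere 0 1 - B)" by (auto simp: space_M)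
  also have "measure M \<dots> = 1 - measure M (sphere 0 1 - B)"
    by (rule prob_compl[OF borel_Int_sets(2)[OF B(1)]])
  also have "measure M (sphere 0 1 - B) = 0" using B(2) by (simp add: measure_def)
  finally show ?thesis by simp
qed

text \<open>Cut a measure on the union into disjoint pieces of mass \<open>b i\<close> and energy
  \<open>e i\<close>. Each satisfies \<open>b i \<le> sqrt (c i) * sqrt (e i)\<close>, so
  Cauchy-Schwarz and superadditivity of the energy bound the squared total mass, which is 1, by
  \<open>suminf c * energy M\<close>.\<close>

lemma cap_compact_UN_le:
  fixes B :: "nat \<Rightarrow> (complex ^ 'd) set"
  assumes B: "\<And>i. B i \<in> sets borel"
  shows "cap_compact (\<Union>i. B i) \<le> (\<Sum>i. cap_compact (B i))"
proof (cases "(\<Sum>i. cap_compact (B i)) = \<top>")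
  case False
  define c where "c i = enn2real (cap_compact (B i))" for i
  have c0: "0 \<le> c i" for i by (simp add: c_def)
  have c: "ennreal (c i) = cap_compact (B i)" for i
    using cap_compact_le_1[of "B i"] unfolding c_def by (simp add: le_less_trans[of _ 1])
  have smc: "summable c" using False c0 by (intro summable_suminf_not_top) (simp_all add: c)
  have "cap_compact (\<Union>i. B i) \<le> ennreal (suminf c)"
  proof (rule cap_compact_leI)
    show "0 \<le> suminf c" by (intro suminf_nonneg smc c0)
    fix M assume M: "sphere_prob M" "concentrated_on M (\<Union>i. B i)" and fin: "h2d_energy M \<noteq> \<top>"
    interpret sphere_measure M by (rule sphere_prob_imp_sphere_measure) fact
    define D where "D = disjointed B"
    have D: "D i \<in> sets borel" for i unfolding D_def using B sets.range_disjointed_sets[of B borel] by auto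
    have disj: "disjoint_family_on D I" for I
      using disjoint_family_disjointed[of B] unfolding D_def disjoint_family_on_def by blast
    have UD: "(\<Union>i. D i) = (\<Union>i. B i)" unfolding D_def by (rule UN_disjointed_eq)
    define b where "b i = measure M (sphere 0 1 \<inter> D i)" for i
    define e where "e i = energy (density M (indicator (D i)))" for i
    have bd: "(\<Sum>i<N. b i)\<^sup>2 \<le> suminf c * energy M" for N
    proof -
      have E: "(\<Sum>i<N. h2d_energy (density M (indicator (D i)))) \<le> h2d_energy M"
        by (intro sum_energy_restrict_le D disj) simp
      have fini: "h2d_energy (density M (indicator (D i))) \<noteq> \<top>" if "i < N" for i
      proof
        assume "h2d_energy (density M (indicator (D i))) = \<top>"
        then have "(\<Sum>i<N. h2d_energy (density M (indicator (D i)))) = \<top>"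
          using that by (auto simp: ennreal_sum_eq_top)
        with E fin show False by (simp add: top_unique)
      qed
      have "ennreal (\<Sum>i<N. e i) = (\<Sum>i<N. h2d_energy (density M (indicator (D i))))"
        using fini by (subst sum_ennreal[symmetric]) (auto simp: e_def less_top intro!: sum.cong)
      also have "\<dots> \<le> ennreal (energy M)" using E finite_energy(3)[OF fin] by simp
      finally have E': "(\<Sum>i<N. e i) \<le> energy M" by (simp add: ennreal_le_iff)
      have bi: "b i \<le> sqrt (c i) * sqrt (e i)" if "i < N" for i
      proof -
        have "(b i)\<^sup>2 \<le> c i * e i"
          unfolding b_def e_def using disjointed_subset[of B i]
          by (intro measure_restrict_power2_le[of "B i"] B D fini[OF that] eq_refl[OF c[symmetric]] c0) (simp add: D_def)
        then show ?thesis by (simp add: real_sqrt_mult[symmetric] real_le_rsqrt)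
      qed
      have "(\<Sum>i<N. b i)\<^sup>2 \<le> (\<Sum>i<N. sqrt (c i) * sqrt (e i))\<^sup>2"
        using bi by (intro power_mono sum_mono sum_nonneg) (auto simp: b_def)
      also have "\<dots> \<le> (\<Sum>i<N. (sqrt (c i))\<^sup>2) * (\<Sum>i<N. (sqrt (e i))\<^sup>2)"
        by (rule Cauchy_Schwarz_ineq_sum)
      also have "\<dots> = (\<Sum>i<N. c i) * (\<Sum>i<N. e i)" using c0 by (simp add: e_def)
      also have "\<dots> \<le> suminf c * energy M"
        using c0 E' by (intro mult_mono sum_le_suminf smc suminf_nonneg sum_nonneg) (auto simp: e_def)
      finally show ?thesis .
    qed
    have "(\<lambda>i. b i) sums measure M (\<Union>i. sphere 0 1 \<inter> D i)"
      unfolding b_def using borel_Int_sets(1)[OF D] disj[of UNIV]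
      by (intro finite_measure_UNION) (auto simp: disjoint_family_on_def)
    also have "(\<Union>i. sphere 0 1 \<inter> D i) = sphere 0 1 \<inter> (\<Union>i. B i)" using UD by auto
    also have "measure M \<dots> = 1" using B by (intro sphere_prob_concentrated M) auto
    finally have "(\<lambda>N. (\<Sum>i<N. b i)\<^sup>2) \<longlonglongrightarrow> 1\<^sup>2" unfolding sums_def by (rule tendsto_power)
    from LIMSEQ_le_const2[OF this, of "suminf c * energy M"] bd
    show "1 \<le> suminf c * energy M" by auto
  qed
  also have "ennreal (suminf c) = (\<Sum>i. cap_compact (B i))"
    using smc c0 by (simp add: suminf_ennreal2[symmetric] c)
  finally show ?thesis .
qed simp

section \<open>Inner capacity of relatively open sets\<close>

lemma open_eq_UN_closed:
  fixes U :: "'a::metric_space set"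
  assumes "open U"
  obtains C :: "nat \<Rightarrow> 'a set" where "incseq C" "\<And>n. closed (C n)" "U = (\<Union>n. C n)"
\<comment> \<open>\<open>infdist\<close> to the empty set is 0 by convention, so the sets
  \<open>C n\<close> would be empty for the whole space.\<close>
proof (cases "U = UNIV")
  case True
  then show ?thesis by (intro that[of "\<lambda>_. UNIV"]) auto
next
  case False
  define C where "C n = {x. inverse (real (Suc n)) \<le> infdist x (- U)}" for n
  have "U = (\<Union>n. C n)"
  proof (intro set_eqI iffI)
    fix x assume "x \<in> U"
    then have "infdist x (- U) > 0"
      using assms False by (intro infdist_pos_not_in_closed) auto
    then obtain n where "inverse (real (Suc n)) < infdist x (- U)" using reals_Archimedean by blast
    then show "x \<in> (\<Union>n. C n)" by (auto simp: C_def intro!: exI[of _ n] less_imp_le)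
  next
    fix x assume "x \<in> (\<Union>n. C n)"
    then obtain n where "inverse (real (Suc n)) \<le> infdist x (- U)" by (auto simp: C_def)
    moreover have "inverse (real (Suc n)) > 0" by simp
    ultimately have "infdist x (- U) \<noteq> 0" by linarith
    then show "x \<in> U" by (metis ComplI infdist_zero)
  qed
  moreover have "closed (C n)" for n
    unfolding C_def by (intro closed_Collect_le continuous_intros)
  moreover have "incseq C"
  proof (rule incseq_SucI)
    fix n
    have "inverse (real (Suc (Suc n))) \<le> inverse (real (Suc n))" by (intro le_imp_inverse_le) simp_all
    then show "C n \<subseteq> C (Suc n)" unfolding C_def by (intro Collect_mono impI) (rule order_trans)
  qed
  ultimately show ?thesis using that by blast
qed

text \<open>A measure on \<open>G\<close> gives mass tending to 1 to a compact exhaustion of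
  \<open>G\<close>, and restriction does not raise the energy. Outer capacity can thus be computed
  with \<open>cap_compact\<close> of open sets, to which subadditivity and Chebyshev's inequality
  apply directly.\<close>

lemma inner_cap_open:
  assumes G: "openin (top_of_set (sphere 0 1)) G"
  shows "inner_cap G = cap_compact G"
proof (rule antisym)
  obtain U where U: "open U" "G = sphere 0 1 \<inter> U" using G by (auto simp: openin_open)
  have Gb: "G \<in> sets borel" unfolding U(2) using U(1) by auto
  show "inner_cap G \<le> cap_compact G"
    unfolding inner_cap_def by (rule SUP_least) (auto intro!: cap_compact_mono borel_compact)
  obtain C where C: "incseq C" "\<And>n. closed (C n)" "U = (\<Union>n. C n)"
    using open_eq_UN_closed[OF U(1)] by metis
  define K where "K n = sphere 0 1 \<inter> C n" for n
  have K: "compact (K n)" for n unfolding K_def by (intro compact_Int_closed C) simp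
  then have Kb: "K n \<in> sets borel" for n by (rule borel_compact)
  have UK: "(\<Union>n. K n) = G" unfolding K_def U(2) C(3) by auto
  define c where "c = enn2real (inner_cap G)"
  have "inner_cap G \<le> 1" unfolding inner_cap_def by (intro SUP_least cap_compact_le_1)
  then have c: "inner_cap G = ennreal c" "0 \<le> c"
    unfolding c_def by (simp_all add: le_less_trans[of _ 1])
  have cK: "cap_compact (K n) \<le> ennreal c" for n
    unfolding c(1)[symmetric] inner_cap_def using K UK by (intro SUP_upper) auto
  have "cap_compact G \<le> ennreal c"
  proof (rule cap_compact_leI[OF c(2)])
    fix M assume M: "sphere_prob M" "concentrated_on M G" and fin: "h2d_energy M \<noteq> \<top>"
    interpret sphere_measure M by (rule sphere_prob_imp_sphere_measure) fact
    have "(measure M (sphere 0 1 \<inter> K n))\<^sup>2 \<le> c * energy M" for n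
    proof -
      have le: "h2d_energy (density M (indicator (K n))) \<le> h2d_energy M"
        by (rule energy_restrict_le[OF Kb])
      then have fin': "h2d_energy (density M (indicator (K n))) \<noteq> \<top>" using fin by (auto simp: top_unique)
      have "(measure M (sphere 0 1 \<inter> K n))\<^sup>2 \<le> c * energy (density M (indicator (K n)))"
        by (intro measure_restrict_power2_le[of "K n"] Kb fin' cK c) simp
      also have "\<dots> \<le> c * energy M"
        using le fin c(2) by (intro mult_left_mono enn2real_mono) (auto simp: less_top)
      finally show ?thesis .
    qed
    moreover have "(\<lambda>n. measure M (sphere 0 1 \<inter> K n)) \<longlonglongrightarrow> measure M (\<Union>n. sphere 0 1 \<inter> K n)"
      using borel_Int_sets(1)[OF Kb] C(1)
      by (intro finite_Lim_measure_incseq) (auto simp: K_def incseq_def)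
    moreover have "(\<Union>n. sphere 0 1 \<inter> K n) = sphere 0 1 \<inter> G" using UK by auto
    moreover have "measure M (sphere 0 1 \<inter> G) = 1" by (intro sphere_prob_concentrated M Gb)
    ultimately have le: "\<And>n. (measure M (sphere 0 1 \<inter> K n))\<^sup>2 \<le> c * energy M"
      and lim: "(\<lambda>n. measure M (sphere 0 1 \<inter> K n)) \<longlonglongrightarrow> 1" by simp_all
    have "1\<^sup>2 \<le> c * energy M"
      using le by (intro LIMSEQ_le_const2[OF tendsto_power[OF lim]]) simp
    then show "1 \<le> c * energy M" by simp
  qed
  then show "cap_compact G \<le> inner_cap G" unfolding c(1)[symmetric] .
qed

subsection \<open>Increasing sequences\<close>

text \<open>Provides the competitors for the first variation of the energy. Writing the convex
  combination as a Bernoulli bind yields the probability measure from general facts about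
  kernels.\<close>

lemma sphere_prob_mixture:
  fixes M N :: "(complex ^ 'd) measure"
  assumes M: "sphere_prob M" "sphere_prob N" and s: "0 \<le> s" "s \<le> 1"
  obtains R where "sphere_prob R" "\<And>j. moment R j = (1 - s) * moment M j + s * moment N j"
    "\<And>A. A \<in> sets R \<Longrightarrow> emeasure M A = 0 \<Longrightarrow> emeasure N A = 0 \<Longrightarrow> emeasure R A = 0"
proof -
  interpret M: sphere_measure M by (rule sphere_prob_imp_sphere_measure[OF M(1)])
  interpret N: sphere_measure N by (rule sphere_prob_imp_sphere_measure[OF M(2)])
  have pM: "prob_space M" and pN: "prob_space N" using M by (simp_all add: sphere_prob_def)
  let ?S = "restrict_space borel (sphere 0 1) :: (complex ^ 'd) measure"
  define K where "K b = (if b then N else M)" for b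
  have sp: "prob_space (K b)" "sets (K b) = sets ?S" for b
    using pM pN M.sets_M N.sets_M by (simp_all add: K_def)
  have K: "K \<in> measurable (measure_pmf (bernoulli_pmf s)) (subprob_algebra ?S)"
    using sp by (auto simp: space_subprob_algebra prob_space_imp_subprob_space)
  define R where "R = measure_pmf (bernoulli_pmf s) \<bind> K"
  have sets_R: "sets R = sets ?S"
    unfolding R_def by (rule sets_bind) (simp_all add: sp)
  have "prob_space R"
    unfolding R_def by (rule measure_pmf.prob_space_bind[OF _ K]) (simp add: sp)
  then have R: "sphere_prob R" by (simp add: sphere_prob_def sets_R)
  interpret R: sphere_measure R by (rule sphere_prob_imp_sphere_measure[OF R])
  have nn: "(\<integral>\<^sup>+x. f x \<partial>R) = (\<integral>\<^sup>+x. f x \<partial>N) * ennreal s + (\<integral>\<^sup>+x. f x \<partial>M) * ennreal (1 - s)"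
    if "f \<in> borel_measurable ?S" for f
    unfolding R_def using s by (subst nn_integral_bind[OF that K]) (simp add: K_def)
  show ?thesis
  proof (rule that[OF R])
    fix j :: "'d list \<times> bool"
    \<comment> \<open>The bind formula is one for nonnegative integrals; features are bounded by 2
      in absolute value on the sphere, so the shift makes them nonnegative there.\<close>
    define g where "g z = ennreal (feature j z + 2)" for z :: "complex ^ 'd"
    have I: "(\<integral>\<^sup>+z. g z \<partial>L) = ennreal (moment L j + 2) \<and> 0 \<le> moment L j + 2" if L: "sphere_prob L" for L :: "(complex ^ 'd) measure"
    proof -
      interpret L: sphere_measure L by (rule sphere_prob_imp_sphere_measure[OF L])
      interpret pL: prob_space L using L by (simp add: sphere_prob_def)
      have nonneg: "0 \<le> feature j z + 2" if "z \<in> space L" for z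
        using abs_feature_le[of z j] that by (simp add: L.space_M)
      have eq: "(\<integral>z. feature j z + 2 \<partial>L) = moment L j + 2"
        unfolding moment_def by (subst Bochner_Integration.integral_add) (simp_all add: pL.prob_space)
      have "0 \<le> (\<integral>z. feature j z + 2 \<partial>L)" by (rule integral_nonneg_AE) (use nonneg in auto)
      moreover have "(\<integral>\<^sup>+z. g z \<partial>L) = ennreal (\<integral>z. feature j z + 2 \<partial>L)"
        unfolding g_def by (rule nn_integral_eq_integral) (use nonneg in auto)
      ultimately show ?thesis unfolding eq by simp
    qed
    have "g \<in> borel_measurable ?S"
      unfolding g_def
      by (intro measurable_restrict_space1 measurable_compose[OF _ measurable_ennreal]
          borel_measurable_add borel_measurable_const borel_measurable_continuous_onI continuous_on_feature)
    from nn[OF this] have "ennreal (moment R j + 2) =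
        ennreal (moment N j + 2) * ennreal s + ennreal (moment M j + 2) * ennreal (1 - s)"
      using I[OF R] I[OF M(1)] I[OF M(2)] by simp
    also have "\<dots> = ennreal ((moment N j + 2) * s + (moment M j + 2) * (1 - s))"
      using s I[OF M(1)] I[OF M(2)] by (subst ennreal_plus) (auto simp: ennreal_mult')
    finally have "moment R j + 2 = (moment N j + 2) * s + (moment M j + 2) * (1 - s)"
      using s I[OF R] I[OF M(1)] I[OF M(2)] by (subst (asm) ennreal_inj) auto
    then show "moment R j = (1 - s) * moment M j + s * moment N j" by (simp add: algebra_simps)
  next
    fix A assume A: "A \<in> sets R" "emeasure M A = 0" "emeasure N A = 0"
    have "emeasure R A = (\<integral>\<^sup>+x. indicator A x \<partial>R)" using A(1) by simp
    also have "\<dots> = 0"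
      using A sets_R by (subst nn) (simp_all add: M.sets_M N.sets_M)
    finally show "emeasure R A = 0" .
  qed
qed

section \<open>Harmonic polynomials and Chebyshev's inequality for the capacity\<close>

definition finite_support :: "('j \<Rightarrow> real) \<Rightarrow> bool" where
  "finite_support a \<longleftrightarrow> finite {j. a j \<noteq> 0}"

text \<open>A norm of the coefficients, not of the function: the features are linearly dependent, as
  permuted words give the same monomial and the imaginary part for the empty word is 0. Both
  Cauchy-Schwarz and the parallelogram law are applied to coefficients. An infinite support would
  give the default value 0 of \<open>sum\<close>, hence \<open>finite_support\<close>.\<close>

definition norm_sq :: "('j \<Rightarrow> real) \<Rightarrow> real" where
  "norm_sq a = (\<Sum>j | a j \<noteq> 0. (a j)\<^sup>2)"

definition harmonic_poly :: "('d list \<times> bool \<Rightarrow> real) \<Rightarrow> complex ^ 'd \<Rightarrow> real" where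
  "harmonic_poly a z = (\<Sum>j | a j \<noteq> 0. a j * feature j z)"

lemma norm_sq_superset: "finite A \<Longrightarrow> {j. a j \<noteq> 0} \<subseteq> A \<Longrightarrow> norm_sq a = (\<Sum>j\<in>A. (a j)\<^sup>2)"
  unfolding norm_sq_def by (rule sum.mono_neutral_left) auto

lemma harmonic_poly_superset:
  "finite A \<Longrightarrow> {j. a j \<noteq> 0} \<subseteq> A \<Longrightarrow> harmonic_poly a z = (\<Sum>j\<in>A. a j * feature j z)"
  unfolding harmonic_poly_def by (rule sum.mono_neutral_left) auto

lemma norm_sq_nonneg: "0 \<le> norm_sq a"
  unfolding norm_sq_def by (rule sum_nonneg) simp

lemma finite_support_diff: "finite_support a \<Longrightarrow> finite_support b \<Longrightarrow> finite_support (\<lambda>j. a j - b j)"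
  unfolding finite_support_def by (rule finite_subset[of _ "{j. a j \<noteq> 0} \<union> {j. b j \<noteq> 0}"]) auto

lemma finite_support_mid: "finite_support a \<Longrightarrow> finite_support b \<Longrightarrow> finite_support (\<lambda>j. (a j + b j) / 2)"
  unfolding finite_support_def by (rule finite_subset[of _ "{j. a j \<noteq> 0} \<union> {j. b j \<noteq> 0}"]) auto

lemma norm_sq_parallelogram:
  assumes "finite_support a" "finite_support b"
  shows "norm_sq (\<lambda>j. a j - b j) = 2 * norm_sq a + 2 * norm_sq b - 4 * norm_sq (\<lambda>j. (a j + b j) / 2)"
proof -
  define A where "A = {j. a j \<noteq> 0} \<union> {j. b j \<noteq> 0}"
  have A: "finite A" using assms by (simp add: A_def finite_support_def)
  have e: "norm_sq a = (\<Sum>j\<in>A. (a j)\<^sup>2)" "norm_sq b = (\<Sum>j\<in>A. (b j)\<^sup>2)"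
    "norm_sq (\<lambda>j. a j - b j) = (\<Sum>j\<in>A. (a j - b j)\<^sup>2)"
    "norm_sq (\<lambda>j. (a j + b j) / 2) = (\<Sum>j\<in>A. ((a j + b j) / 2)\<^sup>2)"
    by (intro norm_sq_superset[OF A], force simp: A_def)+
  show ?thesis
    unfolding e sum_distrib_left sum.distrib[symmetric] sum_subtractf[symmetric]
    by (intro sum.cong refl) (simp add: power2_eq_square field_simps)
qed

lemma harmonic_poly_linear:
  assumes "finite_support a" "finite_support b"
  shows "harmonic_poly (\<lambda>j. a j - b j) z = harmonic_poly a z - harmonic_poly b z"
    and "harmonic_poly (\<lambda>j. (a j + b j) / 2) z = (harmonic_poly a z + harmonic_poly b z) / 2"
proof -
  define A where "A = {j. a j \<noteq> 0} \<union> {j. b j \<noteq> 0}"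
  have A: "finite A" using assms by (simp add: A_def finite_support_def)
  have e: "harmonic_poly a z = (\<Sum>j\<in>A. a j * feature j z)" "harmonic_poly b z = (\<Sum>j\<in>A. b j * feature j z)"
    "harmonic_poly (\<lambda>j. a j - b j) z = (\<Sum>j\<in>A. (a j - b j) * feature j z)"
    "harmonic_poly (\<lambda>j. (a j + b j) / 2) z = (\<Sum>j\<in>A. (a j + b j) / 2 * feature j z)"
    by (intro harmonic_poly_superset[OF A], force simp: A_def)+
  show "harmonic_poly (\<lambda>j. a j - b j) z = harmonic_poly a z - harmonic_poly b z"
    unfolding e sum_subtractf[symmetric] by (intro sum.cong refl) (simp add: algebra_simps)
  show "harmonic_poly (\<lambda>j. (a j + b j) / 2) z = (harmonic_poly a z + harmonic_poly b z) / 2"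
    unfolding e sum.distrib[symmetric] sum_divide_distrib by (intro sum.cong refl) (simp add: field_simps)
qed

lemma continuous_on_harmonic_poly: "continuous_on X (harmonic_poly a)"
  unfolding harmonic_poly_def[abs_def] by (intro continuous_on_sum continuous_on_mult continuous_on_const continuous_on_feature)

definition levels_below :: "nat \<Rightarrow> ('d list \<times> bool) set" where
  "levels_below N = (\<Union>n<N. level n)"

lemma finite_levels_below [simp]: "finite (levels_below N :: ('d::finite list \<times> bool) set)"
  by (simp add: levels_below_def)

lemma sum_levels_below:
  fixes f :: "'d::finite list \<times> bool \<Rightarrow> real"
  shows "(\<Sum>j\<in>levels_below N. f j) = (\<Sum>n<N. \<Sum>j\<in>level n. f j)"
  unfolding levels_below_def using level_disjoint
  by (subst sum.UNION_disjoint) auto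

text \<open>Links finite supports to the level-wise form of the energy.\<close>

lemma subset_levels_below:
  assumes "finite (A :: ('d list \<times> bool) set)"
  obtains N where "A \<subseteq> levels_below N"
proof
  show "A \<subseteq> levels_below (Suc (Max (length ` fst ` A)))"
  proof
    fix j assume "j \<in> A"
    then have "length (fst j) \<le> Max (length ` fst ` A)" using assms by (intro Max_ge) auto
    then show "j \<in> levels_below (Suc (Max (length ` fst ` A)))"
      by (cases j) (auto simp: levels_below_def level_def words_def)
  qed
qed

context sphere_measure
begin

lemma sum_moment_le_energy:
  assumes "h2d_energy M \<noteq> \<top>" "finite A"
  shows "(\<Sum>j\<in>A. (moment M j)\<^sup>2) \<le> energy M"
proof -
  obtain N where N: "A \<subseteq> levels_below N" using subset_levels_below[OF assms(2)] .
  have "(\<Sum>j\<in>A. (moment M j)\<^sup>2) \<le> (\<Sum>j\<in>levels_below N. (moment M j)\<^sup>2)"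
    using N by (intro sum_mono2) auto
  also have "\<dots> = (\<Sum>n<N. level_energy M n)" by (simp add: sum_levels_below level_energy_def)
  also have "\<dots> \<le> energy M"
    unfolding finite_energy(2)[OF assms(1)] by (intro sum_le_suminf finite_energy assms) auto
  finally show ?thesis .
qed

lemma integral_harmonic_poly:
  assumes "finite A" "{j. a j \<noteq> 0} \<subseteq> A"
  shows "integrable M (harmonic_poly a)"
    and "(\<integral>z. harmonic_poly a z \<partial>M) = (\<Sum>j\<in>A. a j * moment M j)"
proof -
  have eq: "harmonic_poly a = (\<lambda>z. \<Sum>j\<in>A. a j * feature j z)"
    using harmonic_poly_superset[OF assms] by blast
  show "integrable M (harmonic_poly a)" unfolding eq by simp
  show "(\<integral>z. harmonic_poly a z \<partial>M) = (\<Sum>j\<in>A. a j * moment M j)" unfolding eq by (simp add: moment_def)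
qed

text \<open>Cauchy-Schwarz between coefficients and moments: the energy bounds the squared norm of
  integration against \<open>M\<close> as a functional of the coefficients.\<close>

lemma integral_harmonic_poly_power2_le:
  assumes "finite_support a" "h2d_energy M \<noteq> \<top>"
  shows "(\<integral>z. harmonic_poly a z \<partial>M)\<^sup>2 \<le> norm_sq a * energy M"
proof -
  define A where "A = {j. a j \<noteq> 0}"
  have A: "finite A" using assms(1) by (simp add: A_def finite_support_def)
  have "(\<integral>z. harmonic_poly a z \<partial>M)\<^sup>2 = (\<Sum>j\<in>A. a j * moment M j)\<^sup>2"
    by (subst integral_harmonic_poly(2)[OF A]) (simp_all add: A_def)
  also have "\<dots> \<le> (\<Sum>j\<in>A. (a j)\<^sup>2) * (\<Sum>j\<in>A. (moment M j)\<^sup>2)" by (rule Cauchy_Schwarz_ineq_sum)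
  also have "\<dots> \<le> norm_sq a * energy M"
    unfolding norm_sq_def A_def[symmetric]
    by (intro mult_left_mono sum_moment_le_energy assms A sum_nonneg) simp
  finally show ?thesis .
qed

lemma AE_concentrated: "B \<in> sets borel \<Longrightarrow> concentrated_on M B \<Longrightarrow> AE z in M. z \<in> B"
  by (rule AE_I[of _ _ "sphere 0 1 - B"]) (auto simp: space_M intro!: borel_Int_sets)

end

lemma borel_Collect_harmonic_poly [measurable]:
  "{z. c < harmonic_poly a z} \<in> sets borel" "{z. harmonic_poly a z < c} \<in> sets borel"
  by (auto intro!: borel_open open_Collect_less continuous_on_harmonic_poly)

text \<open>Chebyshev's inequality: a probability measure living where the polynomial exceeds
  \<open>l\<close> integrates it to at least \<open>l\<close>, and the duality bound then forces its
  energy to be at least \<open>l\<^sup>2 / norm_sq a\<close>.\<close>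

lemma cap_compact_harmonic_poly_le:
  assumes a: "finite_support a" and l: "l > 0"
  shows "cap_compact {z. l < harmonic_poly a z} \<le> ennreal (norm_sq a / l\<^sup>2)"
proof (rule cap_compact_leI)
  show "0 \<le> norm_sq a / l\<^sup>2" using norm_sq_nonneg[of a] by simp
  fix M assume M: "sphere_prob M" "concentrated_on M {z. l < harmonic_poly a z}" "h2d_energy M \<noteq> \<top>"
  interpret sphere_measure M by (rule sphere_prob_imp_sphere_measure) fact
  interpret prob_space M using M(1) by (simp add: sphere_prob_def)
  have "(\<integral>z. l \<partial>M) \<le> (\<integral>z. harmonic_poly a z \<partial>M)"
  proof (rule integral_mono_AE)
    show "integrable M (harmonic_poly a)"
      using a by (intro integral_harmonic_poly) (auto simp: finite_support_def)
    show "AE z in M. l \<le> harmonic_poly a z"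
      using AE_concentrated[OF _ M(2)] by (auto elim!: eventually_mono)
  qed simp
  then have "l\<^sup>2 \<le> (\<integral>z. harmonic_poly a z \<partial>M)\<^sup>2" using l by (intro power_mono) (auto simp: prob_space)
  also have "\<dots> \<le> norm_sq a * energy M" by (rule integral_harmonic_poly_power2_le[OF a M(3)])
  finally show "1 \<le> norm_sq a / l\<^sup>2 * energy M" using l by (simp add: field_simps)
qed

text \<open>
  The polynomial is a truncation of the normalised potential of a near-minimiser \<open>\<mu>\<close> of the
  energy; the lower bound is the first variation at \<open>\<mu>\<close> in the direction of \<open>M\<close>.
\<close>

lemma near_extremal_polynomial:
  fixes G :: "(complex ^ 'd) set"
  assumes G: "cap_compact G < ennreal t" and tau: "\<tau> > 0"
  obtains a where "finite_support a" "norm_sq a \<le> t"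
    "\<And>M. \<lbrakk>sphere_prob M; concentrated_on M G; h2d_energy M \<noteq> \<top>\<rbrakk> \<Longrightarrow>
       1 - \<tau> * energy M \<le> (\<integral>z. harmonic_poly a z \<partial>M)"
proof -
  define P where "P = {M. sphere_prob M \<and> concentrated_on M G \<and> h2d_energy M \<noteq> \<top>}"
  have t0: "0 < t" using G by (metis ennreal_neg not_less_zero not_less)
  show ?thesis
  proof (cases "P = {}")
    case True
    \<comment> \<open>No measure competes, so the lower bound is vacuous and the zero polynomial
      qualifies.\<close>
    show ?thesis
      by (rule that[of "\<lambda>_. 0"]) (use True t0 in \<open>auto simp: finite_support_def norm_sq_def P_def\<close>)
  next
    case False
    define m where "m = Inf (energy ` P)"
    have bdd: "bdd_below (energy ` P)" by (rule bdd_belowI[of _ 1]) (auto simp: P_def energy_ge_1)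
    have m_le: "m \<le> energy M" if "M \<in> P" for M
      unfolding m_def using bdd that by (intro cInf_lower) auto
    have m1: "1 \<le> m" unfolding m_def
      using False by (intro cInf_greatest) (auto simp: P_def energy_ge_1)
    define c where "c = enn2real (cap_compact G)"
    have c: "cap_compact G = ennreal c" "0 \<le> c"
      unfolding c_def using cap_compact_le_1[of G] by (simp_all add: le_less_trans[of _ 1])
    have ct: "c < t" using G c by (simp add: ennreal_less_iff)
    have c_e: "1 \<le> c * energy M" if "M \<in> P" for M
      using that c by (intro cap_compactD[of M G]) (auto simp: P_def)
    have "c \<noteq> 0" using c_e False by force
    then have c0: "c > 0" using c(2) by simp
    have "1 / c \<le> m" unfolding m_def
      using False c_e c0 by (intro cInf_greatest) (auto simp: field_simps)
    then have cm: "1 \<le> c * m" using c0 by (simp add: field_simps)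
    \<comment> \<open>\<open>s\<close> is the mixing weight, and its square is the tolerance both
      for near-minimality and for truncation. The bound \<open>t - c\<close> leaves room for
      \<open>norm_sq a \<le> t\<close>; the bound \<open>\<tau> / 8\<close> absorbs the error of the
      first variation.\<close>
    define s where "s = min 1 (min (\<tau> / 8) (t - c))"
    have s: "0 < s" "s \<le> 1" "8 * s \<le> \<tau>" "s \<le> t - c"
      using tau ct by (auto simp: s_def min_def)
    have ss: "s\<^sup>2 \<le> s" using s by (simp add: power2_eq_square mult_left_le_one_le)
    have "\<exists>\<mu>\<in>P. energy \<mu> < m + s\<^sup>2"
      using cInf_lessD[of "energy ` P" "m + s\<^sup>2"] False s(1) unfolding m_def by auto
    then obtain \<mu> where mu: "\<mu> \<in> P" "energy \<mu> < m + s\<^sup>2" by blast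
    have mu': "sphere_prob \<mu>" "concentrated_on \<mu> G" "h2d_energy \<mu> \<noteq> \<top>" using mu(1) by (auto simp: P_def)
    interpret mu: sphere_measure \<mu> by (rule sphere_prob_imp_sphere_measure[OF mu'(1)])
    note fmu = mu.finite_energy[OF mu'(3)]
    have "(\<lambda>N. \<Sum>n<N. level_energy \<mu> n) \<longlonglongrightarrow> energy \<mu>"
      unfolding fmu(2) by (rule summable_LIMSEQ[OF fmu(1)])
    then have "\<forall>\<^sub>F N in sequentially. energy \<mu> - s\<^sup>2 < (\<Sum>n<N. level_energy \<mu> n)"
      using s(1) by (intro order_tendstoD(1)) auto
    then obtain N where N: "energy \<mu> - s\<^sup>2 < (\<Sum>n<N. level_energy \<mu> n)"
      by (auto dest: eventually_happens)
    define A where "A = (levels_below N :: ('d list \<times> bool) set)"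
    have A: "finite A" by (simp add: A_def)
    define x where "x = moment \<mu>"
    define X where "X = (\<Sum>j\<in>A. (x j)\<^sup>2)"
    have X_eq: "X = (\<Sum>n<N. level_energy \<mu> n)"
      by (simp add: X_def A_def x_def sum_levels_below level_energy_def)
    have X: "energy \<mu> - s\<^sup>2 \<le> X" "X \<le> energy \<mu>"
      using N mu.sum_moment_le_energy[OF mu'(3) A] by (simp_all add: X_eq[symmetric]) (simp add: X_def x_def)
    \<comment> \<open>Dividing by \<open>m\<close> brings the integral against the near-minimiser
      close to 1 and the squared norm close to \<open>1 / m\<close>, the reciprocal of the least
      energy.\<close>
    define a where "a j = (if j \<in> A then x j / m else 0)" for j
    have supp: "{j. a j \<noteq> 0} \<subseteq> A" by (auto simp: a_def)
    have fs: "finite_support a" unfolding finite_support_def using supp A by (rule finite_subset)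
    have "norm_sq a = X / m\<^sup>2"
      unfolding norm_sq_superset[OF A supp] X_def sum_divide_distrib
      by (intro sum.cong refl) (simp add: a_def power_divide)
    also have "X / m\<^sup>2 \<le> t"
    proof -
      have "m + s\<^sup>2 \<le> t * m\<^sup>2"
      proof -
        have "m * 1 \<le> m * (c * m)" using cm m1 by (intro mult_left_mono) auto
        moreover have "(t - c) * 1 \<le> (t - c) * m\<^sup>2" using ct m1 by (intro mult_left_mono) (auto simp: one_le_power)
        ultimately show ?thesis using s(4) ss by (simp add: algebra_simps power2_eq_square)
      qed
      then show ?thesis using X mu(2) m1 by (simp add: field_simps)
    qed
    finally have na: "norm_sq a \<le> t" .
    show ?thesis
    proof (rule that[OF fs na])
      fix \<nu> :: "(complex ^ 'd) measure" assume nu: "sphere_prob \<nu>" "concentrated_on \<nu> G" "h2d_energy \<nu> \<noteq> \<top>"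
      interpret nu: sphere_measure \<nu> by (rule sphere_prob_imp_sphere_measure[OF nu(1)])
      note fnu = nu.finite_energy[OF nu(3)]
      define e where "e = energy \<nu>"
      have e: "1 \<le> e" "m \<le> e" using energy_ge_1[OF nu(1,3)] m_le[of \<nu>] nu by (auto simp: e_def P_def)
      define y where "y = moment \<nu>"
      define B where "B = (\<Sum>j\<in>A. x j * y j)"
      obtain \<rho> where rho: "sphere_prob \<rho>" "\<And>j. moment \<rho> j = (1 - s) * x j + s * y j"
        "\<And>A. A \<in> sets \<rho> \<Longrightarrow> emeasure \<mu> A = 0 \<Longrightarrow> emeasure \<nu> A = 0 \<Longrightarrow> emeasure \<rho> A = 0"
        using sphere_prob_mixture[OF mu'(1) nu(1), of s] s unfolding x_def y_def by auto
      interpret rho: sphere_measure \<rho> by (rule sphere_prob_imp_sphere_measure[OF rho(1)])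
      have rho_conc: "concentrated_on \<rho> G"
        using rho(3) mu'(2) nu(2) emeasure_notin_sets by blast
      \<comment> \<open>A majorant of the levels of \<rho> without cross terms, used for the tail
        beyond level \<open>N\<close>: there \<mu> contributes at most \<open>2 * s\<^sup>2\<close>
        and \<nu> carries the factor \<open>s\<^sup>2\<close>, so the whole tail is of second order
        in \<open>s\<close>.\<close>
      define d where "d n = 2 * level_energy \<mu> n + 2 * s\<^sup>2 * level_energy \<nu> n" for n
      have lev: "level_energy \<rho> n \<le> d n" for n
      proof -
        have "(moment \<rho> j)\<^sup>2 \<le> 2 * (x j)\<^sup>2 + 2 * s\<^sup>2 * (y j)\<^sup>2" for j
        proof -
          have "(moment \<rho> j)\<^sup>2 \<le> 2 * ((1 - s) * x j)\<^sup>2 + 2 * (s * y j)\<^sup>2"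
            unfolding rho(2) using sum_squares_bound[of "(1 - s) * x j" "s * y j"]
            by (simp add: power2_sum)
          also have "((1 - s) * x j)\<^sup>2 \<le> (x j)\<^sup>2"
            using s by (auto simp: power_mult_distrib intro!: mult_left_le_one_le power_le_one)
          finally show ?thesis by (simp add: power_mult_distrib)
        qed
        then show ?thesis
          unfolding d_def level_energy_def sum_distrib_left sum.distrib[symmetric] x_def y_def
          by (intro sum_mono) auto
      qed
      have d_sums: "d sums (2 * energy \<mu> + 2 * s\<^sup>2 * e)"
        unfolding d_def e_def fmu(2) fnu(2) by (intro sums_add sums_mult summable_sums fmu fnu)
      have sm_rho: "summable (level_energy \<rho>)"
        by (rule summable_comparison_test'[OF sums_summable[OF d_sums], of 0]) (use lev in simp)
      have fin_rho: "h2d_energy \<rho> \<noteq> \<top>"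
        unfolding rho.h2d_energy_eq_suminf using sm_rho by (subst suminf_ennreal2) auto
      have "m \<le> energy \<rho>" using rho(1) rho_conc fin_rho by (intro m_le) (simp add: P_def)
      also have "energy \<rho> = (\<Sum>n. level_energy \<rho> (n + N)) + (\<Sum>n<N. level_energy \<rho> n)"
        unfolding rho.finite_energy(2)[OF fin_rho] by (rule suminf_split_initial_segment[OF sm_rho])
      finally have m_rho: "m \<le> (\<Sum>n. level_energy \<rho> (n + N)) + (\<Sum>n<N. level_energy \<rho> n)" .
      have "(\<Sum>n. level_energy \<rho> (n + N)) \<le> (\<Sum>n. d (n + N))"
        by (intro suminf_le lev summable_ignore_initial_segment sm_rho sums_summable[OF d_sums])
      also have "\<dots> = 2 * energy \<mu> + 2 * s\<^sup>2 * e - (\<Sum>n<N. d n)"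
        using suminf_minus_initial_segment[OF sums_summable[OF d_sums], of N] sums_unique[OF d_sums] by simp
      finally have tail: "(\<Sum>n. level_energy \<rho> (n + N)) \<le> 2 * energy \<mu> + 2 * s\<^sup>2 * e - (\<Sum>n<N. d n)" .
      have dX: "2 * X \<le> (\<Sum>n<N. d n)"
        unfolding X_eq sum_distrib_left d_def by (intro sum_mono) simp
      have "(\<Sum>j\<in>A. (y j - x j)\<^sup>2) \<le> (\<Sum>j\<in>A. 2 * (x j)\<^sup>2 + 2 * (y j)\<^sup>2)"
      proof (rule sum_mono)
        fix j show "(y j - x j)\<^sup>2 \<le> 2 * (x j)\<^sup>2 + 2 * (y j)\<^sup>2"
          using zero_le_power2[of "y j + x j"] by (simp add: power2_eq_square algebra_simps)
      qed
      also have "\<dots> = 2 * X + 2 * (\<Sum>j\<in>A. (y j)\<^sup>2)" by (simp add: X_def sum.distrib sum_distrib_left)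
      finally have "(\<Sum>j\<in>A. (y j - x j)\<^sup>2) \<le> 2 * X + 2 * e"
        using nu.sum_moment_le_energy[OF nu(3) A] by (simp add: y_def e_def)
      then have yx: "s\<^sup>2 * (\<Sum>j\<in>A. (y j - x j)\<^sup>2) \<le> s\<^sup>2 * (2 * X + 2 * e)" by (intro mult_left_mono) auto
      have "(\<Sum>n<N. level_energy \<rho> n) = (\<Sum>j\<in>A. ((1 - s) * x j + s * y j)\<^sup>2)"
        by (simp add: A_def sum_levels_below level_energy_def rho(2))
      also have "\<dots> = (\<Sum>j\<in>A. (x j)\<^sup>2 + 2 * s * (x j * y j - (x j)\<^sup>2) + s\<^sup>2 * (y j - x j)\<^sup>2)"
        by (intro sum.cong refl) (simp add: power2_eq_square algebra_simps)
      also have "\<dots> = X + 2 * s * (B - X) + s\<^sup>2 * (\<Sum>j\<in>A. (y j - x j)\<^sup>2)"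
        by (simp only: X_def B_def sum.distrib sum_distrib_left[symmetric] sum_subtractf)
      finally have main: "m \<le> 2 * energy \<mu> + 2 * s\<^sup>2 * e - 2 * X + (X + 2 * s * (B - X) + s\<^sup>2 * (2 * X + 2 * e))"
        using m_rho tail dX yx by linarith
      \<comment> \<open>All errors are of second order: near-minimality and the tail of \<mu> cost
        \<open>2 * s\<^sup>2\<close> in total, the tail of \<nu> \<open>2 * s\<^sup>2 * e\<close>,
        the quadratic term \<open>6 * s\<^sup>2 * e\<close>; 13 is a generous total because
        \<open>e \<ge> 1\<close>. Dividing by \<open>s\<close> leaves an error linear in
        \<open>s\<close>.\<close>
      have "2 * s * (B - X) \<ge> - 13 * s\<^sup>2 * e"
      proof -
        have "X \<le> 2 * e" using X mu(2) e ss s(2) by linarith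
        then have "s\<^sup>2 * (2 * X + 2 * e) \<le> s\<^sup>2 * (6 * e)" by (intro mult_left_mono) auto
        moreover have "s\<^sup>2 * 1 \<le> s\<^sup>2 * e" using e by (intro mult_left_mono) auto
        ultimately show ?thesis using main X mu(2) e by (simp add: algebra_simps)
      qed
      then have "s * (2 * (B - X)) \<ge> s * (- 13 * s * e)" by (simp add: power2_eq_square algebra_simps)
      then have BX: "2 * (B - X) \<ge> - 13 * s * e" using s(1) by (simp only: mult_le_cancel_left_pos)
      have "s * 1 \<le> s * e" using s(1) e by (intro mult_left_mono) auto
      then have "s\<^sup>2 \<le> s * e" using ss by simp
      moreover have "m \<le> energy \<mu>" by (rule m_le[OF mu(1)])
      ultimately have "B \<ge> m - 7.5 * (s * e)" using BX X by (simp add: algebra_simps)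
      moreover have "0 < s * e" using s(1) e by simp
      ultimately have "m - 8 * (s * e) \<le> B" by linarith
      have "1 - \<tau> * e \<le> 1 - 8 * (s * e)" using mult_right_mono[OF s(3), of e] e by (simp add: mult.assoc)
      also have "\<dots> \<le> (m - 8 * (s * e)) / m"
      proof -
        have "8 * (s * e) * 1 \<le> 8 * (s * e) * m" using m1 \<open>0 < s * e\<close> by (intro mult_left_mono) auto
        then show ?thesis using m1 by (simp add: field_simps)
      qed
      also have "\<dots> \<le> B / m" using \<open>m - 8 * (s * e) \<le> B\<close> m1 by (intro divide_right_mono) auto
      also have "\<dots> = (\<Sum>j\<in>A. a j * y j)"
        unfolding B_def sum_divide_distrib by (intro sum.cong refl) (simp add: a_def)
      also have "\<dots> = (\<integral>z. harmonic_poly a z \<partial>\<nu>)"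
        unfolding y_def by (rule nu.integral_harmonic_poly(2)[OF A supp, symmetric])
      finally show "1 - \<tau> * energy \<nu> \<le> (\<integral>z. harmonic_poly a z \<partial>\<nu>)" unfolding e_def .
    qed
  qed
qed

text \<open>
  Near-minimisers over a decreasing sequence of midpoint convex sets form a Cauchy sequence by the
  parallelogram law; this replaces weak limits and needs no completeness.
\<close>

lemma parallelogram_selection:
  fixes C :: "nat \<Rightarrow> ('j \<Rightarrow> real) set" and q :: "nat \<Rightarrow> real"
  assumes ne: "\<And>n. C n \<noteq> {}" and dec: "decseq C"
    and fs: "\<And>n a. a \<in> C n \<Longrightarrow> finite_support a" and bd: "\<And>n a. a \<in> C n \<Longrightarrow> norm_sq a \<le> t"
    and mid: "\<And>n a b. a \<in> C n \<Longrightarrow> b \<in> C n \<Longrightarrow> (\<lambda>j. (a j + b j) / 2) \<in> C n"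
    and q: "\<And>n. 0 < q n" "decseq q"
  obtains h where "\<And>k. h k \<in> C k" "\<And>k. norm_sq (\<lambda>j. h (Suc k) j - h k j) \<le> q k"
proof -
  define d where "d n = Inf (norm_sq ` C n)" for n
  have bdd: "bdd_below (norm_sq ` C n)" for n by (rule bdd_belowI[of _ 0]) (auto simp: norm_sq_nonneg)
  have d_le: "d n \<le> norm_sq a" if "a \<in> C n" for a n
    unfolding d_def using bdd that by (intro cInf_lower) auto
  have "d n \<le> t" for n
  proof -
    obtain a where "a \<in> C n" using ne by blast
    then show ?thesis using d_le bd by (meson order_trans)
  qed
  moreover have "incseq d"
  proof (rule incseq_SucI)
    fix n
    have "C (Suc n) \<subseteq> C n" using dec by (simp add: decseq_Suc_iff)
    then show "d n \<le> d (Suc n)" unfolding d_def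
      using ne bdd by (intro cInf_superset_mono) auto
  qed
  ultimately obtain L where L: "d \<longlonglongrightarrow> L" "\<And>n. d n \<le> L"
    using incseq_convergent[of d t] by metis
  have "\<exists>N. \<forall>n\<ge>N. L - q k / 4 < d n" for k
    using order_tendstoD(1)[OF L(1), of "L - q k / 4"] q(1)[of k] by (simp add: eventually_sequentially)
  then obtain f where f: "\<And>k n. n \<ge> f k \<Longrightarrow> L - q k / 4 < d n" by metis
  \<comment> \<open>Summing \<open>f\<close> makes \<open>N\<close> monotone and at least
    \<open>f k\<close>; the summand \<open>k\<close> gives
    \<open>C (N k) \<subseteq> C k\<close>.\<close>
  define N where "N k = k + (\<Sum>i\<le>k. f i)" for k
  have Nk: "k \<le> N k" "N k \<le> N (Suc k)" "f k \<le> N k" for k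
    by (auto simp: N_def intro: trans_le_add2 member_le_sum)
  have "\<exists>a\<in>C (N k). norm_sq a < d (N k) + q k / 8" for k
    using cInf_lessD[of "norm_sq ` C (N k)" "d (N k) + q k / 8"] ne q(1)[of k] unfolding d_def by auto
  then obtain h where h: "\<And>k. h k \<in> C (N k)" "\<And>k. norm_sq (h k) < d (N k) + q k / 8" by metis
  show ?thesis
  proof (rule that[of h])
    show "h k \<in> C k" for k using h(1) decseqD[OF dec Nk(1)[of k]] by blast
    fix k
    have mem: "h (Suc k) \<in> C (N k)" using h(1) decseqD[OF dec Nk(2)[of k]] by blast
    have "norm_sq (\<lambda>j. h (Suc k) j - h k j) = 2 * norm_sq (h (Suc k)) + 2 * norm_sq (h k)
        - 4 * norm_sq (\<lambda>j. (h (Suc k) j + h k j) / 2)"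
      by (intro norm_sq_parallelogram fs[OF h(1)])
    moreover have "d (N k) \<le> norm_sq (\<lambda>j. (h (Suc k) j + h k j) / 2)"
      by (intro d_le mid mem h)
    moreover have "q (Suc k) \<le> q k" using q(2) by (simp add: decseq_Suc_iff)
    \<comment> \<open>The terms \<open>2 * (L - d (N k))\<close> cost at most
      \<open>q k / 2\<close>, and the two near-minimality errors, each doubled, at most
      \<open>q k / 2\<close> together.\<close>
    ultimately show "norm_sq (\<lambda>j. h (Suc k) j - h k j) \<le> q k"
      using h(2)[of k] h(2)[of "Suc k"] L(2)[of "N (Suc k)"] f[OF Nk(3)[of k]] q(1)[of k] by argo
  qed
qed

text \<open>Lets open sets of the whole space stand for relatively open subsets of the sphere in the
  estimates that follow.\<close>

lemma cap_compact_Int_sphere: "cap_compact (sphere 0 1 \<inter> B) = cap_compact B"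
proof -
  have "sphere 0 1 - sphere 0 1 \<inter> B = sphere 0 1 - B" by blast
  then show ?thesis by (simp add: cap_compact_def)
qed

lemma outer_cap_le:
  assumes "open U" "E \<subseteq> U" "E \<subseteq> sphere 0 1"
  shows "outer_cap E \<le> cap_compact U"
proof -
  have o: "openin (top_of_set (sphere 0 1)) (sphere 0 1 \<inter> U)" using assms(1) by (rule openin_open_Int)
  then have "outer_cap E \<le> inner_cap (sphere 0 1 \<inter> U)"
    unfolding outer_cap_def using assms by (intro INF_lower) auto
  then show ?thesis using o by (simp add: inner_cap_open cap_compact_Int_sphere)
qed

text \<open>That \<open>E\<close> lies in the sphere is a conclusion: otherwise the infimum runs
  over no sets and equals \<open>\<top>\<close>.\<close>

lemma outer_cap_less:
  assumes "outer_cap E < c"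
  obtains U where "open U" "E \<subseteq> U" "E \<subseteq> sphere 0 1" "cap_compact U < c"
proof -
  obtain G where G: "openin (top_of_set (sphere 0 1)) G" "E \<subseteq> G" "inner_cap G < c"
    using assms unfolding outer_cap_def INF_less_iff by auto
  from G(1) obtain U where U: "open U" "G = sphere 0 1 \<inter> U" by (auto simp: openin_open)
  have "cap_compact U < c"
    using G(3) inner_cap_open[OF G(1)] by (simp add: U(2) cap_compact_Int_sphere)
  then show ?thesis using that U G(2) by blast
qed

lemma cap_compact_empty: "cap_compact {} = 0"
proof -
  have False if M: "sphere_prob M" "emeasure M (sphere 0 1) = 0" for M :: "(complex ^ 'd) measure"
  proof -
    interpret sphere_measure M by (rule sphere_prob_imp_sphere_measure[OF M(1)])
    interpret prob_space M using M by (simp add: sphere_prob_def)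
    show False using emeasure_space_1 M(2) by (simp add: space_M)
  qed
  then have *: "{M :: (complex ^ 'd) measure. sphere_prob M \<and> concentrated_on M {}} = {}" by auto
  show ?thesis unfolding cap_compact_def * by (simp add: bot_ennreal)
qed

lemma cap_compact_Un_le:
  assumes "A \<in> sets borel" "B \<in> sets borel"
  shows "cap_compact (A \<union> B) \<le> cap_compact A + cap_compact B"
proof -
  define F where "F i = (if i = 0 then A else if i = Suc 0 then B else {})" for i
  have "cap_compact (\<Union>i. F i) \<le> (\<Sum>i. cap_compact (F i))"
    using assms by (intro cap_compact_UN_le) (auto simp: F_def)
  also have "(\<Union>i. F i) = A \<union> B" by (auto simp: F_def split: if_splits)
  also have "(\<Sum>i. cap_compact (F i)) = (\<Sum>i\<in>{0, Suc 0}. cap_compact (F i))"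
    by (intro suminf_finite) (auto simp: F_def cap_compact_empty)
  also have "\<dots> = cap_compact A + cap_compact B" by (simp add: F_def)
  finally show ?thesis .
qed

lemma cap_compact_UN_le_ennreal:
  fixes B :: "nat \<Rightarrow> (complex ^ 'd) set"
  assumes "\<And>i. B i \<in> sets borel" "\<And>i. cap_compact (B i) \<le> ennreal (c i)" "\<And>i. 0 \<le> c i" "c sums s"
  shows "cap_compact (\<Union>i. B i) \<le> ennreal s"
proof -
  have "cap_compact (\<Union>i. B i) \<le> (\<Sum>i. cap_compact (B i))" by (rule cap_compact_UN_le) fact
  also have "\<dots> \<le> (\<Sum>i. ennreal (c i))" by (intro suminf_le assms) auto
  also have "\<dots> = ennreal s"
    using assms(3,4) by (subst suminf_ennreal2) (auto simp: sums_iff)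
  finally show ?thesis .
qed

lemma half_powers_sums: "(\<lambda>k. c * (1/2) ^ Suc k) sums (c :: real)"
  using sums_mult[OF power_half_series, of c] by simp

text \<open>One open set has to work for all \<open>E k\<close> although their neighbourhoods of
  small capacity need not be nested. A superlevel set of the first polynomial takes this role; each
  later polynomial carries the information about \<open>E k\<close> back to it at a summable cost in
  capacity.\<close>

lemma outer_cap_incseq_UN_approx:
  fixes E :: "nat \<Rightarrow> (complex ^ 'd) set"
  assumes E: "incseq E" "\<And>n. E n \<subseteq> sphere 0 1" and t: "\<And>n. outer_cap (E n) < ennreal t"
    and eps: "0 < \<epsilon>" "\<epsilon> < 1/4"
  shows "outer_cap (\<Union>n. E n) \<le> ennreal (t / (1 - 3 * \<epsilon>)\<^sup>2 + \<epsilon>)"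
proof -
  have t0: "0 < t" using t[of 0] by (metis ennreal_neg not_less_zero not_less)
  define w where "w k = (1/2 :: real) ^ Suc k" for k
  have w: "0 < w k" for k by (simp add: w_def)
  have w_sums: "(\<lambda>k. c * w k) sums c" for c unfolding w_def by (rule half_powers_sums)
  have w_dec: "w n \<le> w m" if "m \<le> n" for m n unfolding w_def using that by (intro power_decreasing) auto
  \<comment> \<open>The budget for index \<open>k\<close> is \<open>\<epsilon> * w k\<close>. The
    choice of \<open>\<tau> k\<close> makes \<open>\<tau> k / \<epsilon>\<close>, the capacity of
    the defect set of \<open>h k\<close>, half of it; \<open>q k\<close> makes Chebyshev's bound at
    height \<open>\<epsilon> * w k\<close> a quarter of it, once for each sign.\<close>
  define \<tau> where "\<tau> k = \<epsilon>\<^sup>2 * w k / 2" for k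
  have tau: "0 < \<tau> k" for k using eps w by (simp add: \<tau>_def)
  define q where "q k = (\<epsilon> * w k) ^ 3 / 4" for k
  \<comment> \<open>A substitute in the mean for the pointwise bound that the polynomial is at least
    1 on \<open>V\<close>; it survives shrinking \<open>V\<close>, lowering \<open>k\<close> and
    averaging.\<close>
  define large where "large k V a \<longleftrightarrow> (\<forall>M. sphere_prob M \<longrightarrow> concentrated_on M V \<longrightarrow> h2d_energy M \<noteq> \<top> \<longrightarrow>
      1 - \<tau> k * energy M \<le> (\<integral>z. harmonic_poly a z \<partial>M))" for k V and a :: "'d list \<times> bool \<Rightarrow> real"
  have large_mono: "large k V' a" if "large l V a" "V' \<subseteq> V" "k \<le> l" "V' \<in> sets borel" for k l V V' a
    unfolding large_def
  proof (intro allI impI)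
    fix M assume M: "sphere_prob M" "concentrated_on M V'" "h2d_energy M \<noteq> \<top>"
    interpret sphere_measure M by (rule sphere_prob_imp_sphere_measure) fact
    have "emeasure M (sphere 0 1 - V) \<le> emeasure M (sphere 0 1 - V')"
      using that by (intro emeasure_mono borel_Int_sets) auto
    then have "concentrated_on M V" using M(2) by simp
    then have "1 - \<tau> l * energy M \<le> (\<integral>z. harmonic_poly a z \<partial>M)"
      using that(1) M unfolding large_def by blast
    moreover have "\<tau> l \<le> \<tau> k" using w_dec[OF that(3)] eps by (simp add: \<tau>_def)
    then have "\<tau> l * energy M \<le> \<tau> k * energy M" using finite_energy(4)[OF M(3)] by (intro mult_right_mono)
    ultimately show "1 - \<tau> k * energy M \<le> (\<integral>z. harmonic_poly a z \<partial>M)" by linarith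
  qed
  \<comment> \<open>The neighbourhood is quantified inside: any neighbourhood of
    \<open>E (Suc k)\<close> is one of \<open>E k\<close>, so \<open>C\<close> decreases, and two
    elements are averaged over the intersection of their neighbourhoods.\<close>
  define C where "C k = {a. finite_support a \<and> norm_sq a \<le> t \<and> (\<exists>V. open V \<and> E k \<subseteq> V \<and> large k V a)}" for k
  obtain h where h: "\<And>k. h k \<in> C k" "\<And>k. norm_sq (\<lambda>j. h (Suc k) j - h k j) \<le> q k"
  proof (rule parallelogram_selection[of C t q])
    show "C n \<noteq> {}" for n
    proof -
      obtain U where U: "open U" "E n \<subseteq> U" "cap_compact U < ennreal t"
        using outer_cap_less[OF t[of n]] by metis
      obtain a where "finite_support a" "norm_sq a \<le> t"
        "\<And>M. \<lbrakk>sphere_prob M; concentrated_on M U; h2d_energy M \<noteq> \<top>\<rbrakk> \<Longrightarrow>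
           1 - \<tau> n * energy M \<le> (\<integral>z. harmonic_poly a z \<partial>M)"
        using near_extremal_polynomial[OF U(3) tau[of n]] by metis
      then have "a \<in> C n" using U unfolding C_def large_def by blast
      then show ?thesis by blast
    qed
    show "decseq C"
    proof (rule decseq_SucI, rule subsetI)
      fix k a assume "a \<in> C (Suc k)"
      then obtain V where a: "finite_support a" "norm_sq a \<le> t" and V: "open V" "E (Suc k) \<subseteq> V" "large (Suc k) V a"
        unfolding C_def by blast
      have "E k \<subseteq> V" using V(2) incseqD[OF E(1), of k "Suc k"] by auto
      moreover have "large k V a" using V by (intro large_mono[OF V(3)]) auto
      ultimately show "a \<in> C k" using a V(1) unfolding C_def by blast
    qed
    show "finite_support a" "norm_sq a \<le> t" if "a \<in> C n" for a n using that by (auto simp: C_def)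
    show "(\<lambda>j. (a j + b j) / 2) \<in> C k" if ab: "a \<in> C k" "b \<in> C k" for k a b
    proof -
      from ab(1) obtain V where a: "finite_support a" "norm_sq a \<le> t" and V: "open V" "E k \<subseteq> V" "large k V a"
        unfolding C_def by blast
      from ab(2) obtain W where b: "finite_support b" "norm_sq b \<le> t" and W: "open W" "E k \<subseteq> W" "large k W b"
        unfolding C_def by blast
      have la: "large k (V \<inter> W) a" "large k (V \<inter> W) b"
        using V(1) W(1) by (auto intro!: large_mono[OF V(3)] large_mono[OF W(3)])
      have "large k (V \<inter> W) (\<lambda>j. (a j + b j) / 2)"
        unfolding large_def
      proof (intro allI impI)
        fix M assume M: "sphere_prob M" "concentrated_on M (V \<inter> W)" "h2d_energy M \<noteq> \<top>"
        interpret sphere_measure M by (rule sphere_prob_imp_sphere_measure) fact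
        have i: "integrable M (harmonic_poly a)" "integrable M (harmonic_poly b)"
          using a(1) b(1) by (auto intro!: integral_harmonic_poly(1)[OF _ subset_refl] simp: finite_support_def)
        have "(\<integral>z. harmonic_poly (\<lambda>j. (a j + b j) / 2) z \<partial>M) =
            ((\<integral>z. harmonic_poly a z \<partial>M) + (\<integral>z. harmonic_poly b z \<partial>M)) / 2"
          using i by (simp add: harmonic_poly_linear(2)[OF a(1) b(1)])
        moreover have "1 - \<tau> k * energy M \<le> (\<integral>z. harmonic_poly a z \<partial>M)"
          "1 - \<tau> k * energy M \<le> (\<integral>z. harmonic_poly b z \<partial>M)"
          using la M unfolding large_def by blast+
        ultimately show "1 - \<tau> k * energy M \<le> (\<integral>z. harmonic_poly (\<lambda>j. (a j + b j) / 2) z \<partial>M)"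
          by simp
      qed
      moreover have "norm_sq (\<lambda>j. (a j + b j) / 2) \<le> t"
        using norm_sq_parallelogram[OF a(1) b(1)] norm_sq_nonneg[of "\<lambda>j. a j - b j"] a(2) b(2) by linarith
      moreover have "finite_support (\<lambda>j. (a j + b j) / 2)" by (rule finite_support_mid[OF a(1) b(1)])
      ultimately show ?thesis using V W unfolding C_def by blast
    qed
    show "0 < q n" for n using eps w by (simp add: q_def)
    show "decseq q"
      unfolding decseq_def q_def using w_dec eps w by (auto intro!: divide_right_mono power_mono simp: less_imp_le)
  qed blast
  have fs: "finite_support (h k)" and nt: "norm_sq (h k) \<le> t" for k using h(1)[of k] by (auto simp: C_def)
  obtain V where V: "\<And>k. open (V k)" "\<And>k. E k \<subseteq> V k" "\<And>k. large k (V k) (h k)"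
  proof -
    have "\<forall>k. \<exists>V. open V \<and> E k \<subseteq> V \<and> large k V (h k)" using h(1) unfolding C_def by blast
    from choice[OF this] show ?thesis using that by blast
  qed
  define p where "p k = harmonic_poly (h k)" for k
  have pc: "continuous_on UNIV (p k)" for k unfolding p_def by (rule continuous_on_harmonic_poly)
  \<comment> \<open>Off the exceptional sets \<open>Up\<close>, \<open>Dn\<close>, \<open>Ex\<close>, of small total capacity, every \<open>E k\<close> lies in \<open>Z\<close>.\<close>
  define Up where "Up k = {z. \<epsilon> * w k < p (Suc k) z - p k z}" for k
  define Dn where "Dn k = {z. \<epsilon> * w k < p k z - p (Suc k) z}" for k
  define Ex where "Ex k = {z. p k z < 1 - \<epsilon>} \<inter> V k" for k
  define Z where "Z = {z. 1 - 3 * \<epsilon> < p 0 z}"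
  have op: "open (Up k)" "open (Dn k)" "open (Ex k)" "open Z" for k
    unfolding Up_def Dn_def Ex_def Z_def using V(1)
    by (auto intro!: open_Collect_less continuous_intros open_Int pc)
  \<comment> \<open>Index 0 carries the main set and later indices the exceptional sets, so that
    countable subadditivity is applied once.\<close>
  define B where "B i = (case i of 0 \<Rightarrow> Z | Suc k \<Rightarrow> (Up k \<union> Dn k) \<union> Ex k)" for i
  have opB: "open (B i)" for i using op by (auto simp: B_def split: nat.split)
  define c where "c i = (case i of 0 \<Rightarrow> t / (1 - 3 * \<epsilon>)\<^sup>2 | Suc k \<Rightarrow> \<epsilon> * w k)" for i
  have ew: "0 < \<epsilon> * w k" for k using eps(1) w by simp
  have capZ: "cap_compact Z \<le> ennreal (t / (1 - 3 * \<epsilon>)\<^sup>2)"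
  proof -
    have "cap_compact Z \<le> ennreal (norm_sq (h 0) / (1 - 3 * \<epsilon>)\<^sup>2)"
      unfolding Z_def p_def using eps by (intro cap_compact_harmonic_poly_le fs) simp
    also have "\<dots> \<le> ennreal (t / (1 - 3 * \<epsilon>)\<^sup>2)" using nt[of 0] by (intro ennreal_leI divide_right_mono) auto
    finally show ?thesis .
  qed
  have q_eq: "q k / (\<epsilon> * w k)\<^sup>2 = \<epsilon> * w k / 4" for k
    using ew[of k] by (simp add: q_def power3_eq_cube power2_eq_square)
  have capUp: "cap_compact (Up k) \<le> ennreal (\<epsilon> * w k / 4)" for k
  proof -
    have "cap_compact (Up k) \<le> ennreal (norm_sq (\<lambda>j. h (Suc k) j - h k j) / (\<epsilon> * w k)\<^sup>2)"
      unfolding Up_def p_def harmonic_poly_linear(1)[OF fs fs, symmetric]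
      by (intro cap_compact_harmonic_poly_le finite_support_diff fs ew)
    also have "\<dots> \<le> ennreal (q k / (\<epsilon> * w k)\<^sup>2)" using h(2) by (intro ennreal_leI divide_right_mono) auto
    finally show ?thesis unfolding q_eq .
  qed
  have capDn: "cap_compact (Dn k) \<le> ennreal (\<epsilon> * w k / 4)" for k
  proof -
    have "cap_compact (Dn k) \<le> ennreal (norm_sq (\<lambda>j. h k j - h (Suc k) j) / (\<epsilon> * w k)\<^sup>2)"
      unfolding Dn_def p_def harmonic_poly_linear(1)[OF fs fs, symmetric]
      by (intro cap_compact_harmonic_poly_le finite_support_diff fs ew)
    also have "norm_sq (\<lambda>j. h k j - h (Suc k) j) = norm_sq (\<lambda>j. h (Suc k) j - h k j)"
      unfolding norm_sq_def by (intro sum.cong) (auto simp: power2_commute)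
    also have "ennreal (\<dots> / (\<epsilon> * w k)\<^sup>2) \<le> ennreal (q k / (\<epsilon> * w k)\<^sup>2)"
      using h(2) by (intro ennreal_leI divide_right_mono) auto
    finally show ?thesis unfolding q_eq .
  qed
  have capEx: "cap_compact (Ex k) \<le> ennreal (\<epsilon> * w k / 2)" for k
  proof (rule cap_compact_leI)
    show "0 \<le> \<epsilon> * w k / 2" using ew[of k] by simp
    fix M assume M: "sphere_prob M" "concentrated_on M (Ex k)" "h2d_energy M \<noteq> \<top>"
    interpret sphere_measure M by (rule sphere_prob_imp_sphere_measure) fact
    interpret prob_space M using M(1) by (simp add: sphere_prob_def)
    have Exb: "Ex k \<in> sets borel" using op(3) by simp
    have "emeasure M (sphere 0 1 - V k) \<le> emeasure M (sphere 0 1 - Ex k)"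
      by (intro emeasure_mono borel_Int_sets Exb) (auto simp: Ex_def)
    then have "1 - \<tau> k * energy M \<le> (\<integral>z. p k z \<partial>M)"
      using V(3)[of k] M unfolding large_def p_def by simp
    also have "\<dots> \<le> (\<integral>z. 1 - \<epsilon> \<partial>M)"
    proof (rule integral_mono_AE)
      show "integrable M (p k)"
        unfolding p_def using fs by (intro integral_harmonic_poly(1)[OF _ subset_refl]) (simp add: finite_support_def)
      show "AE z in M. p k z \<le> 1 - \<epsilon>"
        using AE_concentrated[OF Exb M(2)] by (auto simp: Ex_def elim!: eventually_mono)
    qed simp
    finally have "\<epsilon> \<le> \<tau> k * energy M" by (simp add: prob_space)
    then show "1 \<le> \<epsilon> * w k / 2 * energy M"
      using eps(1) by (simp add: \<tau>_def power2_eq_square mult.assoc)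
  qed
  have capB: "cap_compact (B i) \<le> ennreal (c i)" for i
  proof (cases i)
    case 0
    then show ?thesis using capZ by (simp add: B_def c_def)
  next
    case (Suc k)
    have "cap_compact (B i) = cap_compact ((Up k \<union> Dn k) \<union> Ex k)" by (simp add: B_def Suc)
    also have "\<dots> \<le> cap_compact (Up k \<union> Dn k) + cap_compact (Ex k)"
      using op by (intro cap_compact_Un_le) auto
    also have "\<dots> \<le> (cap_compact (Up k) + cap_compact (Dn k)) + cap_compact (Ex k)"
      using op by (intro add_right_mono cap_compact_Un_le) auto
    also have "\<dots> \<le> (ennreal (\<epsilon> * w k / 4) + ennreal (\<epsilon> * w k / 4)) + ennreal (\<epsilon> * w k / 2)"
      by (intro add_mono capUp capDn capEx)
    also have "\<dots> = ennreal (c i)"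
      using ew[of k] by (simp add: c_def Suc flip: ennreal_plus)
    finally show ?thesis .
  qed
  have c_sums: "c sums (\<epsilon> + t / (1 - 3 * \<epsilon>)\<^sup>2)"
  proof -
    have "(\<lambda>k. c (Suc k)) sums \<epsilon>" using w_sums[of \<epsilon>] by (simp add: c_def)
    moreover have "c 0 = t / (1 - 3 * \<epsilon>)\<^sup>2" by (simp add: c_def)
    ultimately show ?thesis using sums_Suc[of c \<epsilon>] by metis
  qed
  have cover: "E k \<subseteq> (\<Union>i. B i)" for k
  proof (rule subsetI, rule ccontr)
    fix x assume x: "x \<in> E k" "x \<notin> (\<Union>i. B i)"
    have nb: "x \<notin> Z" "x \<notin> Up i" "x \<notin> Dn i" "x \<notin> Ex i" for i
      using x(2) UN_I[of 0 UNIV x B] UN_I[of "Suc i" UNIV x B] by (auto simp: B_def)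
    have step: "\<bar>p (Suc i) x - p i x\<bar> \<le> \<epsilon> * w i" for i
      using nb(2,3)[of i] by (auto simp: Up_def Dn_def)
    have tele: "\<bar>p n x - p 0 x\<bar> \<le> (\<Sum>i<n. \<epsilon> * w i)" for n
    proof (induction n)
      case (Suc n)
      then show ?case using step[of n] by simp
    qed simp
    have "(\<Sum>i<k. \<epsilon> * w i) \<le> \<epsilon>"
      using sum_le_suminf[of "\<lambda>i. \<epsilon> * w i" "{..<k}"] w_sums[of \<epsilon>] ew by (simp add: sums_iff less_imp_le)
    moreover have "p k x \<ge> 1 - \<epsilon>" using nb(4)[of k] V(2) x(1) by (auto simp: Ex_def)
    moreover have "p 0 x \<le> 1 - 3 * \<epsilon>" using nb(1) by (simp add: Z_def)
    \<comment> \<open>Telescoping gives \<open>p 0 x \<ge> 1 - 2 * \<epsilon>\<close>; the threshold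
      \<open>1 - 3 * \<epsilon>\<close> leaves a strict margin.\<close>
    ultimately show False using eps(1) tele[of k] by linarith
  qed
  have "outer_cap (\<Union>n. E n) \<le> cap_compact (\<Union>i. B i)"
    using opB cover E(2) by (intro outer_cap_le) blast+
  also have "\<dots> \<le> ennreal (\<epsilon> + t / (1 - 3 * \<epsilon>)\<^sup>2)"
  proof (rule cap_compact_UN_le_ennreal[OF _ capB _ c_sums])
    show "B i \<in> sets borel" for i using opB by simp
    show "0 \<le> c i" for i using t0 ew by (auto simp: c_def less_imp_le split: nat.split)
  qed
  finally show ?thesis by (simp add: add.commute)
qed

section \<open>Continuity of the outer capacity from below\<close>

lemma outer_cap_mono:
  assumes "E \<subseteq> F"
  shows "outer_cap E \<le> outer_cap F"
  unfolding outer_cap_def using assms by (intro INF_superset_mono) auto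

text \<open>A number strictly above the supremum is a strict bound for every term, so the
  approximation applies; letting \<epsilon> tend to 0 removes its loss.\<close>

lemma outer_cap_incseq_tendsto:
  fixes E :: "nat \<Rightarrow> (complex ^ 'd) set"
  assumes E: "incseq E" "\<And>n. E n \<subseteq> sphere 0 1"
  shows "(\<lambda>n. outer_cap (E n)) \<longlonglongrightarrow> outer_cap (\<Union>n. E n)"
proof -
  define L where "L = (SUP n. outer_cap (E n))"
  have inc: "incseq (\<lambda>n. outer_cap (E n))"
    using E(1) by (auto simp: incseq_def intro: outer_cap_mono)
  have "outer_cap (\<Union>n. E n) \<le> L"
  proof (rule dense_ge)
    fix u assume u: "L < u"
    show "outer_cap (\<Union>n. E n) \<le> u"
    proof (cases u)
      case (real t)
      have t: "outer_cap (E n) < ennreal t" for n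
        using u real SUP_upper[of n UNIV "\<lambda>n. outer_cap (E n)"] unfolding L_def by (metis UNIV_I le_less_trans)
      have "((\<lambda>\<epsilon>. ennreal (t / (1 - 3 * \<epsilon>)\<^sup>2 + \<epsilon>)) \<longlongrightarrow> ennreal (t / (1 - 3 * 0)\<^sup>2 + 0)) (at_right 0)"
        by (intro tendsto_intros) auto
      then have "outer_cap (\<Union>n. E n) \<le> ennreal (t / (1 - 3 * 0)\<^sup>2 + 0)"
      proof (rule tendsto_lowerbound)
        have "\<forall>\<^sub>F \<epsilon> in at_right (0::real). 0 < \<epsilon> \<and> \<epsilon> < 1/4"
          using eventually_at_right_real[of 0 "1/4::real"] by simp
        then show "\<forall>\<^sub>F \<epsilon> in at_right 0. outer_cap (\<Union>n. E n) \<le> ennreal (t / (1 - 3 * \<epsilon>)\<^sup>2 + \<epsilon>)"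
          by eventually_elim (intro outer_cap_incseq_UN_approx E t; simp)
      qed simp
      then show ?thesis using real by simp
    qed simp
  qed
  moreover have "L \<le> outer_cap (\<Union>n. E n)"
    unfolding L_def by (intro SUP_least outer_cap_mono) auto
  ultimately have "outer_cap (\<Union>n. E n) = L" by (rule antisym)
  then show ?thesis unfolding L_def using LIMSEQ_SUP[OF inc] by simp
qed

subsection \<open>Capacitability of Borel sets\<close>

text \<open>The projection form of analytic sets with Baire space as parameter space. Its
  coordinates are what Choquet's argument bounds one after the other.\<close>

definition analytic :: "'a::topological_space set \<Rightarrow> bool" where
  "analytic A \<longleftrightarrow> (\<exists>H :: ('a \<times> (nat \<Rightarrow> nat)) set. closed H \<and> A = fst ` H)"

lemma analytic_closed: "closed A \<Longrightarrow> analytic A"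
  unfolding analytic_def by (intro exI[of _ "A \<times> UNIV"]) (auto simp: closed_Times)

text \<open>Coordinate 0 of the parameter selects the set, the shifted parameter witnesses
  membership in it. The condition on coordinate 0 is clopen because \<open>nat\<close> is
  discrete.\<close>

lemma analytic_UN:
  fixes A :: "nat \<Rightarrow> 'a::topological_space set"
  assumes "\<And>n. analytic (A n)"
  shows "analytic (\<Union>n. A n)"
proof -
  obtain H :: "nat \<Rightarrow> ('a \<times> (nat \<Rightarrow> nat)) set"
    where H: "\<And>n. closed (H n)" "\<And>n. A n = fst ` H n"
    using assms unfolding analytic_def by metis
  define G where "G = {p :: 'a \<times> (nat \<Rightarrow> nat). (fst p, \<lambda>k. snd p (Suc k)) \<in> H (snd p 0)}"
  have "G = (\<Inter>n. {p. snd p 0 \<noteq> n} \<union> (\<lambda>p. (fst p, \<lambda>k. snd p (Suc k))) -` H n)"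
    by (auto simp: G_def)
  moreover have "closed ({p :: 'a \<times> (nat \<Rightarrow> nat). snd p 0 \<noteq> n} \<union> (\<lambda>p. (fst p, \<lambda>k. snd p (Suc k))) -` H n)" for n
  proof (rule closed_Un)
    have c: "continuous_on UNIV (\<lambda>p :: 'a \<times> (nat \<Rightarrow> nat). snd p i)" for i
      by (rule continuous_on_product_then_coordinatewise[OF continuous_on_snd[OF continuous_on_id]])
    have "closed ((\<lambda>p :: 'a \<times> (nat \<Rightarrow> nat). snd p 0) -` (- {n}))"
      by (rule closed_vimage[OF _ c]) (simp add: closed_def discrete_topology_class.open_discrete)
    then show "closed {p :: 'a \<times> (nat \<Rightarrow> nat). snd p 0 \<noteq> n}" by (simp add: vimage_def)
    show "closed ((\<lambda>p. (fst p, \<lambda>k. snd p (Suc k))) -` H n)"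
      by (intro closed_vimage[OF H(1)] continuous_on_Pair continuous_on_fst continuous_on_id
            continuous_on_coordinatewise_then_product c)
  qed
  ultimately have "closed G" by (metis (no_types, lifting) closed_INT)
  moreover have "(\<Union>n. A n) = fst ` G"
  proof
    show "(\<Union>n. A n) \<subseteq> fst ` G"
    proof clarify
      fix x n assume "x \<in> A n"
      then obtain f where "(x, f) \<in> H n" using H(2) by force
      then have "(x, case_nat n f) \<in> G" by (simp add: G_def)
      then show "x \<in> fst ` G" by force
    qed
    show "fst ` G \<subseteq> (\<Union>n. A n)" using H(2) by (force simp: G_def)
  qed
  ultimately show ?thesis unfolding analytic_def by blast
qed

text \<open>One parameter codes a whole sequence of parameters by pairing indices, one for each
  set.\<close>

lemma analytic_INT:
  fixes A :: "nat \<Rightarrow> 'a::topological_space set"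
  assumes "\<And>n. analytic (A n)"
  shows "analytic (\<Inter>n. A n)"
proof -
  obtain H :: "nat \<Rightarrow> ('a \<times> (nat \<Rightarrow> nat)) set"
    where H: "\<And>n. closed (H n)" "\<And>n. A n = fst ` H n"
    using assms unfolding analytic_def by metis
  define G where "G = (\<Inter>n. (\<lambda>p :: 'a \<times> (nat \<Rightarrow> nat). (fst p, \<lambda>k. snd p (prod_encode (n, k)))) -` H n)"
  have "closed ((\<lambda>p :: 'a \<times> (nat \<Rightarrow> nat). (fst p, \<lambda>k. snd p (prod_encode (n, k)))) -` H n)" for n
  proof -
    have c: "continuous_on UNIV (\<lambda>p :: 'a \<times> (nat \<Rightarrow> nat). snd p i)" for i
      by (rule continuous_on_product_then_coordinatewise[OF continuous_on_snd[OF continuous_on_id]])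
    show ?thesis
      by (intro closed_vimage[OF H(1)] continuous_on_Pair continuous_on_fst continuous_on_id
            continuous_on_coordinatewise_then_product c)
  qed
  then have "closed G" unfolding G_def by blast
  moreover have "(\<Inter>n. A n) = fst ` G"
  proof
    show "(\<Inter>n. A n) \<subseteq> fst ` G"
    proof
      fix x assume "x \<in> (\<Inter>n. A n)"
      then have "\<forall>n. \<exists>f. (x, f) \<in> H n" using H(2) by force
      then obtain f where f: "\<And>n. (x, f n) \<in> H n" by metis
      have "(x, \<lambda>m. f (fst (prod_decode m)) (snd (prod_decode m))) \<in> G"
        using f by (simp add: G_def)
      then show "x \<in> fst ` G" by force
    qed
    show "fst ` G \<subseteq> (\<Inter>n. A n)" using H(2) by (force simp: G_def)
  qed
  ultimately show ?thesis unfolding analytic_def by blast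
qed

lemma analytic_open:
  fixes U :: "'a::metric_space set"
  assumes "open U"
  shows "analytic U"
proof -
  obtain C :: "nat \<Rightarrow> 'a set" where "\<And>n. closed (C n)" "U = (\<Union>n. C n)"
    using open_eq_UN_closed[OF assms] by metis
  then show ?thesis by (simp add: analytic_UN analytic_closed)
qed

text \<open>Analyticity need not pass to complements, so the induction carries the set and its
  complement together; unions and intersections then exchange roles.\<close>

lemma analytic_borel:
  fixes E :: "'a::metric_space set"
  assumes "E \<in> sets borel"
  shows "analytic E"
proof -
  have "E \<in> sigma_sets UNIV {S. open S}" using assms by (simp add: borel_def)
  then have "analytic E \<and> analytic (- E)"
  proof induction
    case (Basic a)
    then show ?case by (auto intro: analytic_open analytic_closed)
  next
    case Empty
    then show ?case by (auto intro: analytic_closed)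
  next
    case (Compl a)
    then show ?case by (simp add: Compl_eq_Diff_UNIV[symmetric])
  next
    case (Union a)
    then show ?case by (simp add: analytic_UN analytic_INT Compl_UN)
  qed
  then show ?thesis by simp
qed

text \<open>Continuity from below bounds one parameter coordinate at a time without letting the
  capacity drop to \<open>t\<close>. Once all coordinates are bounded, the parameters form a compact
  set, so the projection \<open>F\<close> is compact; continuity from above on closures carries
  \<open>t\<close> over to \<open>F\<close>.\<close>

lemma choquet_capacitability:
  fixes S :: "'a::metric_space set"
  assumes S: "compact S" and c: "choquet_capacity_on S c"
    and E: "E \<subseteq> S" "E \<in> sets borel" and t: "t < c E"
  obtains F where "compact F" "F \<subseteq> E" "t \<le> c F"
proof -
  note c = c[unfolded choquet_capacity_on_def]
  have mono: "c A \<le> c B" if "A \<subseteq> B" "B \<subseteq> S" for A B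
    using c[THEN conjunct2, THEN conjunct1] that by blast
  have dec: "(\<lambda>n. c (A n)) \<longlonglongrightarrow> c (\<Inter>n. A n)" if "decseq A" "\<And>n. compact (A n)" "\<And>n. A n \<subseteq> S" for A
    using c[THEN conjunct2, THEN conjunct2, THEN conjunct1, rule_format, OF that(1)] that(2,3) by simp
  have inc: "(\<lambda>n. c (A n)) \<longlonglongrightarrow> c (\<Union>n. A n)" if "incseq A" "\<And>n. A n \<subseteq> S" for A
    using c[THEN conjunct2, THEN conjunct2, THEN conjunct2, rule_format, OF that(1)] that(2) by simp
  obtain H :: "('a \<times> (nat \<Rightarrow> nat)) set" where H: "closed H" "E = fst ` H"
    using analytic_borel[OF E(2)] unfolding analytic_def by blast
  \<comment> \<open>The part of \<open>E\<close> whose witnesses have their first coordinates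
    bounded by the list \<open>l\<close>; it increases to \<open>P l\<close> as a further bound
    grows.\<close>
  define P where "P l = fst ` {p \<in> H. \<forall>i<length l. snd p i \<le> l ! i}" for l
  have PE: "P l \<subseteq> E" for l using H(2) by (auto simp: P_def)
  have P0: "P [] = E" using H(2) by (simp add: P_def)
  have step: "\<exists>m. t < c (P (l @ [m]))" if "t < c (P l)" for l
  proof -
    have "incseq (\<lambda>m. P (l @ [m]))"
    proof (rule incseq_SucI)
      fix m
      have "{p \<in> H. \<forall>i<length (l @ [m]). snd p i \<le> (l @ [m]) ! i} \<subseteq>
        {p \<in> H. \<forall>i<length (l @ [Suc m]). snd p i \<le> (l @ [Suc m]) ! i}"
        by (auto simp: nth_append less_Suc_eq le_SucI)
      then show "P (l @ [m]) \<subseteq> P (l @ [Suc m])" unfolding P_def by blast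
    qed
    then have "(\<lambda>m. c (P (l @ [m]))) \<longlonglongrightarrow> c (\<Union>m. P (l @ [m]))"
      using PE E(1) by (intro inc) auto
    moreover have "(\<Union>m. P (l @ [m])) = P l"
      unfolding P_def by (force simp: nth_append less_Suc_eq)
    ultimately have "\<forall>\<^sub>F m in sequentially. t < c (P (l @ [m]))"
      using that order_tendstoD(1) by metis
    then show ?thesis by (auto dest: eventually_happens)
  qed
  then obtain nx where nx: "\<And>l. t < c (P l) \<Longrightarrow> t < c (P (l @ [nx l]))" by metis
  define L where "L k = ((\<lambda>l. l @ [nx l]) ^^ k) []" for k
  have L: "t < c (P (L k))" for k
    by (induction k) (use t P0 nx in \<open>auto simp: L_def\<close>)
  have len: "length (L k) = k" for k by (induction k) (auto simp: L_def)
  define h where "h i = nx (L i)" for i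
  have Lh: "L k = map h [0..<k]" for k
    by (induction k) (auto simp: L_def h_def)
  define Ek where "Ek k = fst ` {p \<in> H. \<forall>i<k. snd p i \<le> h i}" for k
  have EkP: "Ek k = P (L k)" for k by (auto simp: Ek_def P_def len Lh)
  have EkE: "Ek k \<subseteq> E" for k using EkP PE by simp
  define Q where "Q = (\<Pi>\<^sub>E i\<in>UNIV. {..h i})"
  have Q: "compact Q"
  proof -
    have "compactin (product_topology (\<lambda>i::nat. euclidean :: nat topology) UNIV) Q"
      unfolding Q_def compactin_PiE by (auto simp: finite_imp_compact)
    then show ?thesis by (simp add: euclidean_product_topology)
  qed
  define F where "F = fst ` (H \<inter> (S \<times> Q))"
  have "compact (H \<inter> (S \<times> Q))" by (intro closed_Int_compact H compact_Times S Q)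
  then have Fc: "compact F" unfolding F_def
    by (intro compact_continuous_image continuous_on_fst continuous_on_id)
  have FE: "F \<subseteq> E" using H(2) by (auto simp: F_def)
  have Sc: "closed S" using S by (rule compact_imp_closed)
  \<comment> \<open>Continuity from above is available for compact sets only, hence the closures.
    They may leave \<open>E\<close>, but their intersection lies in \<open>F\<close>.\<close>
  define D where "D k = closure (Ek k)" for k
  have DS: "D k \<subseteq> S" for k unfolding D_def using EkE E(1) Sc by (metis closure_minimal order_trans)
  have Dc: "compact (D k)" for k
    using compact_Int_closed[OF S, of "D k"] DS[of k] by (simp add: D_def Int_absorb1)
  have "(\<Inter>k. D k) \<subseteq> F"
  proof
    fix x assume x: "x \<in> (\<Inter>k. D k)"
    have "\<exists>p\<in>H. (\<forall>i<k. snd p i \<le> h i) \<and> dist (fst p) x < inverse (real (Suc k))" for k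
    proof -
      have "x \<in> closure (Ek k)" using x by (auto simp: D_def)
      then have "\<exists>y\<in>Ek k. dist y x < inverse (real (Suc k))"
        unfolding closure_approachable by simp
      then obtain y where "y \<in> Ek k" "dist y x < inverse (real (Suc k))" by blast
      moreover from this(1) obtain p where "p \<in> H" "\<forall>i<k. snd p i \<le> h i" "y = fst p"
        unfolding Ek_def by blast
      ultimately show ?thesis by blast
    qed
    then obtain p where p: "\<And>k. p k \<in> H" "\<And>k i. i < k \<Longrightarrow> snd (p k) i \<le> h i"
      "\<And>k. dist (fst (p k)) x < inverse (real (Suc k))" by metis
    \<comment> \<open>Only the first \<open>k\<close> coordinates of \<open>p k\<close> are bounded.
      Capping all of them moves the parameters into the compact set \<open>Q\<close> and alters
      coordinate \<open>i\<close> only for \<open>k \<le> i\<close>, so limits of coordinates are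
      unaffected.\<close>
    define f where "f k = (\<lambda>i. min (snd (p k) i) (h i))" for k
    have "f k \<in> Q" for k by (auto simp: f_def Q_def)
    then obtain g r where g: "g \<in> Q" "strict_mono (r :: nat \<Rightarrow> nat)" "(f \<circ> r) \<longlonglongrightarrow> g"
      using seq_compactE[OF compact_imp_seq_compact[OF Q], of f] by metis
    have fi: "(\<lambda>k. (f \<circ> r) k i) \<longlonglongrightarrow> g i" for i
      using g(3) limitin_componentwise[of "\<lambda>_. euclidean" UNIV "f \<circ> r" g sequentially]
      by (simp add: euclidean_product_topology)
    have "(\<lambda>k. snd (p (r k)) i) \<longlonglongrightarrow> g i" for i
    proof (rule Lim_transform_eventually[OF fi])
      show "\<forall>\<^sub>F k in sequentially. (f \<circ> r) k i = snd (p (r k)) i"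
        using eventually_gt_at_top[of i]
      proof eventually_elim
        case (elim k)
        then have "i < r k" using seq_suble[OF g(2), of k] by linarith
        then show ?case using p(2)[of i "r k"] by (simp add: f_def)
      qed
    qed
    then have s2: "(\<lambda>k. snd (p (r k))) \<longlonglongrightarrow> g"
      using limitin_componentwise[of "\<lambda>_. euclidean" UNIV "\<lambda>k. snd (p (r k))" g sequentially]
      by (simp add: euclidean_product_topology)
    have "(\<lambda>k. fst (p k)) \<longlonglongrightarrow> x"
    proof (rule metric_LIMSEQ_I)
      fix e :: real assume "e > 0"
      then obtain N where N: "inverse (real (Suc N)) < e" using reals_Archimedean by blast
      have "dist (fst (p k)) x < e" if "k \<ge> N" for k
      proof -
        have "inverse (real (Suc k)) \<le> inverse (real (Suc N))" using that by simp
        then show ?thesis using p(3)[of k] N by linarith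
      qed
      then show "\<exists>no. \<forall>n\<ge>no. dist (fst (p n)) x < e" by blast
    qed
    then have "(\<lambda>k. fst (p (r k))) \<longlonglongrightarrow> x"
      using LIMSEQ_subseq_LIMSEQ[OF _ g(2)] by (fastforce simp: o_def)
    from tendsto_Pair[OF this s2] have "(\<lambda>k. p (r k)) \<longlonglongrightarrow> (x, g)" by simp
    from closed_sequentially[OF H(1) _ this] have "(x, g) \<in> H" using p(1) by simp
    moreover have "x \<in> S" using x DS[of 0] by auto
    ultimately show "x \<in> F" using g(1) unfolding F_def by (intro image_eqI[of x fst "(x, g)"]) auto
  qed
  moreover have "F \<subseteq> S" using FE E by blast
  ultimately have "c (\<Inter>k. D k) \<le> c F" by (rule mono)
  moreover have "t \<le> c (\<Inter>k. D k)"
  proof (rule LIMSEQ_le_const)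
    have "decseq Ek"
    proof (rule decseq_SucI)
      show "Ek (Suc k) \<subseteq> Ek k" for k
        unfolding Ek_def by (rule image_mono) auto
    qed
    then have "decseq D" unfolding decseq_def D_def by (simp add: closure_mono)
    then show "(\<lambda>k. c (D k)) \<longlonglongrightarrow> c (\<Inter>k. D k)" by (intro dec Dc DS)
    have "t \<le> c (D k)" for k
    proof -
      have "c (Ek k) \<le> c (D k)" unfolding D_def using DS[of k] by (intro mono closure_subset) (simp add: D_def)
      then show ?thesis using L[of k] EkP[of k] by (metis less_imp_le less_le_trans)
    qed
    then show "\<exists>N. \<forall>n\<ge>N. t \<le> c (D n)" by blast
  qed
  ultimately have "t \<le> c F" by simp
  with Fc FE show ?thesis using that by blast
qed

subsection \<open>Weak limits and compact sets\<close>

text \<open>At the first differing digit the leading term is \<open>1 / 3 ^ j\<close>, while all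
  later digits together amount to at most half of it. In base 2 they could cancel it.\<close>

lemma ternary_series_gap:
  fixes a b :: "nat \<Rightarrow> bool"
  defines "s \<equiv> \<lambda>a. \<Sum>i. of_bool (a i) / 3 ^ i :: real"
  assumes "a k \<noteq> b k"
  shows "\<bar>s a - s b\<bar> \<ge> 1 / (2 * 3 ^ k)"
proof -
  have sm: "summable (\<lambda>i. of_bool (c i) / 3 ^ i :: real)" for c
    by (rule summable_comparison_test'[OF summable_geometric[of "1/3::real"], of 0])
       (auto simp: power_divide of_bool_def)
  define j where "j = (LEAST j. a j \<noteq> b j)"
  have j: "a j \<noteq> b j" unfolding j_def by (rule LeastI[of _ k]) fact
  have lt: "a i = b i" if "i < j" for i using not_less_Least[of i] that unfolding j_def by blast
  have "j \<le> k" unfolding j_def by (rule Least_le) fact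
  define d where "d i = (of_bool (a i) - of_bool (b i)) / (3 ^ i :: real)" for i
  have smd: "summable d" unfolding d_def diff_divide_distrib by (intro summable_diff sm)
  have "s a - s b = (\<Sum>i. d i)"
    unfolding s_def d_def diff_divide_distrib by (rule suminf_diff[OF sm sm])
  also have "\<dots> = (\<Sum>i. d (i + Suc j)) + (\<Sum>i<Suc j. d i)"
    by (rule suminf_split_initial_segment[OF smd])
  also have "(\<Sum>i<Suc j. d i) = d j"
    using lt by (simp add: d_def)
  finally have eq: "s a - s b = (\<Sum>i. d (i + Suc j)) + d j" .
  have g: "(\<lambda>i. (1/3) ^ i / (3 ^ Suc j :: real)) sums (1 / (1 - 1/3) / 3 ^ Suc j)"
    by (rule sums_divide[OF geometric_sums]) simp
  have "\<bar>\<Sum>i. d (i + Suc j)\<bar> \<le> (\<Sum>i. (1/3) ^ i / (3 ^ Suc j :: real))"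
  proof -
    have le: "\<bar>d (i + Suc j)\<bar> \<le> (1/3) ^ i / (3 ^ Suc j :: real)" for i
      by (auto simp: d_def power_add power_divide of_bool_def)
    have "summable (\<lambda>i. \<bar>d (i + Suc j)\<bar>)"
      by (rule summable_comparison_test'[OF sums_summable[OF g], of 0]) (use le in auto)
    then show ?thesis
      using summable_rabs suminf_le[OF le _ sums_summable[OF g]] by (meson order_trans)
  qed
  also have "\<dots> = 1 / (2 * 3 ^ j)" using sums_unique[OF g] by simp
  finally have t: "\<bar>\<Sum>i. d (i + Suc j)\<bar> \<le> 1 / (2 * 3 ^ j)" .
  have "\<bar>d j\<bar> = 1 / 3 ^ j" using j by (auto simp: d_def)
  then have "\<bar>s a - s b\<bar> \<ge> 1 / (2 * 3 ^ j)" proof -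
    have "1 / 3 ^ j = 1 / (2 * 3 ^ j) + 1 / (2 * 3 ^ j :: real)" by (simp add: field_simps)
    then show ?thesis using eq t \<open>\<bar>d j\<bar> = _\<close> by linarith
  qed
  moreover have "1 / (2 * 3 ^ k) \<le> 1 / (2 * 3 ^ j :: real)"
    using \<open>j \<le> k\<close> by (simp add: divide_simps power_increasing)
  ultimately show ?thesis by linarith
qed

text \<open>
  The code of a point is the ternary number whose digits record membership in the sets of a
  countable base; the decoding is uniformly continuous on the codes of a compact set.
\<close>

lemma compact_borel_coding:
  fixes S :: "'a::euclidean_space set"
  assumes S: "compact S" "S \<noteq> {}"
  obtains s :: "'a \<Rightarrow> real" and g :: "real \<Rightarrow> 'a" and a
  where "s \<in> borel_measurable borel" "\<And>x. \<bar>s x\<bar> \<le> a" "continuous_on UNIV g" "\<And>x. x \<in> S \<Longrightarrow> g (s x) = x"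
proof -
  obtain B :: "nat \<Rightarrow> 'a set" where B: "\<And>i. open (B i)"
    "\<And>U. open U \<Longrightarrow> \<exists>I. U = \<Union>(B ` I)"
  proof -
    obtain A :: "'a set set" where A: "countable A" "topological_basis A"
      using ex_countable_basis by blast
    have ne: "A \<noteq> {}" using A(2) open_UNIV unfolding topological_basis_def
      by (metis Sup_empty UNIV_not_empty subset_empty)
    show ?thesis
    proof (rule that[of "from_nat_into A"])
      show "open (from_nat_into A i)" for i
        using from_nat_into[OF ne] A(2) topological_basis_open by blast
      fix U :: "'a set" assume "open U"
      then obtain A' where A': "A' \<subseteq> A" "U = \<Union>A'" using A(2) unfolding topological_basis_def by metis
      have "U = \<Union>(from_nat_into A ` (to_nat_on A ` A'))"
        using A' A(1) by (auto simp: from_nat_into_to_nat_on subset_iff)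
      then show "\<exists>I. U = \<Union>(from_nat_into A ` I)" by blast
    qed
  qed
  define s :: "'a \<Rightarrow> real" where "s x = (\<Sum>i. of_bool (x \<in> B i) / 3 ^ i)" for x
  have sm: "summable (\<lambda>i. of_bool (c i) / 3 ^ i :: real)" for c
    by (rule summable_comparison_test'[OF summable_geometric[of "1/3::real"], of 0])
       (auto simp: power_divide of_bool_def)
  have meas: "s \<in> borel_measurable borel"
  proof -
    have "(\<lambda>x. of_bool (x \<in> B i) / 3 ^ i :: real) \<in> borel_measurable borel" for i
      using B(1)[of i] by (intro borel_measurable_divide borel_measurable_const) (simp_all add: of_bool_def)
    then show ?thesis unfolding s_def by (intro borel_measurable_suminf)
  qed
  have bd: "\<bar>s x\<bar> \<le> 3/2" for x
  proof -
    have "0 \<le> s x" unfolding s_def by (intro suminf_nonneg sm) auto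
    moreover have "s x \<le> (\<Sum>i. (1/3) ^ i)" unfolding s_def
      by (intro suminf_le sm summable_geometric) (auto simp: power_divide of_bool_def)
    ultimately show ?thesis using suminf_geometric[of "1/3::real"] by simp
  qed
  \<comment> \<open>Finitely many base sets of small diameter cover \<open>S\<close>. Codes closer
    than the gap at the largest of their indices record the same memberships in all of them, so the
    two points share a small set.\<close>
  have sep: "\<exists>d>0. \<forall>x\<in>S. \<forall>y\<in>S. \<bar>s x - s y\<bar> < d \<longrightarrow> dist x y < e" if "e > 0" for e
  proof -
    define J where "J = {i. \<exists>z. B i \<subseteq> ball z (e/2)}"
    have "S \<subseteq> (\<Union>i\<in>J. B i)"
    proof
      fix x assume "x \<in> S"
      obtain I where I: "ball x (e/2) = \<Union>(B ` I)" using B(2)[OF open_ball] by blast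
      then obtain i where "i \<in> I" "x \<in> B i" using \<open>e > 0\<close> by (metis UN_E centre_in_ball half_gt_zero)
      then show "x \<in> (\<Union>i\<in>J. B i)" using I unfolding J_def by blast
    qed
    then obtain T where T: "T \<subseteq> J" "finite T" "S \<subseteq> (\<Union>i\<in>T. B i)"
      using compactE_image[OF S(1), of J B] B(1) by metis
    define N where "N = Max (insert 0 T)"
    have N: "i \<le> N" if "i \<in> T" for i using that T(2) by (simp add: N_def)
    have "dist x y < e" if xy: "x \<in> S" "y \<in> S" "\<bar>s x - s y\<bar> < 1 / (2 * 3 ^ N)" for x y
    proof -
      obtain i where i: "i \<in> T" "x \<in> B i" using T(3) xy(1) by blast
      have "y \<in> B i"
      proof (rule ccontr)
        assume "y \<notin> B i"
        then have "1 / (2 * 3 ^ i) \<le> \<bar>s x - s y\<bar>"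
          unfolding s_def using ternary_series_gap[of "\<lambda>i. x \<in> B i" i "\<lambda>i. y \<in> B i"] i(2) by simp
        moreover have "1 / (2 * 3 ^ N) \<le> 1 / (2 * 3 ^ i :: real)"
          using N[OF i(1)] by (simp add: divide_simps power_increasing)
        ultimately show False using xy(3) by linarith
      qed
      obtain z where "B i \<subseteq> ball z (e/2)" using T(1) i(1) unfolding J_def by blast
      then have "dist z x < e/2" "dist z y < e/2" using i(2) \<open>y \<in> B i\<close> by auto
      then show ?thesis using dist_triangle_half_r by blast
    qed
    then show ?thesis by (intro exI[of _ "1 / (2 * 3 ^ N)"]) auto
  qed
  have inj: "inj_on s S"
  proof (rule inj_onI, rule ccontr)
    fix x y assume "x \<in> S" "y \<in> S" "s x = s y" "x \<noteq> y"
    then show False using sep[of "dist x y"] by force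
  qed
  define h where "h = inv_into S s"
  have h: "h (s x) = x" if "x \<in> S" for x using that inj by (simp add: h_def)
  have uc: "uniformly_continuous_on (s ` S) h"
    unfolding uniformly_continuous_on_def
  proof (intro allI impI)
    fix e :: real assume "e > 0"
    from sep[OF this] obtain d where d: "d > 0" "\<And>x y. x \<in> S \<Longrightarrow> y \<in> S \<Longrightarrow> \<bar>s x - s y\<bar> < d \<Longrightarrow> dist x y < e" by blast
    show "\<exists>d>0. \<forall>x\<in>s ` S. \<forall>x'\<in>s ` S. dist x' x < d \<longrightarrow> dist (h x') (h x) < e"
      by (rule exI[of _ d]) (use d in \<open>auto simp: h dist_real_def\<close>)
  qed
  obtain k where k: "uniformly_continuous_on (closure (s ` S)) k" "\<And>x. x \<in> s ` S \<Longrightarrow> h x = k x"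
    using uniformly_continuous_on_extension_on_closure[OF uc] by metis
  \<comment> \<open>The code itself is only Borel; continuity is required of the decoding alone.
    Dugundji's theorem extends it from the closed set of limits of codes to the line.\<close>
  obtain g where g: "continuous_on UNIV g" "\<And>x. x \<in> closure (s ` S) \<Longrightarrow> g x = k x"
  proof (rule Dugundji[of "UNIV :: 'a set" UNIV "closure (s ` S)" k])
    show "continuous_on (closure (s ` S)) k" by (rule uniformly_continuous_imp_continuous[OF k(1)])
  qed auto
  have "g (s x) = x" if "x \<in> S" for x
    using that g(2)[of "s x"] k(2)[of "s x"] h[of x] closure_subset[of "s ` S"] by auto
  with meas bd g(1) show ?thesis using that by blast
qed

text \<open>Codes push the measures to the line, where boundedness gives tightness and Helly's
  theorem applies; the decoding pushes the limit back. Test functions composed with the continuous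
  decoding stay bounded and continuous. The limit is a measure on the whole space, and where it
  lives is read off later from test functions.\<close>

lemma weakly_convergent_subsequence:
  fixes S :: "'a::euclidean_space set" and M :: "nat \<Rightarrow> 'a measure"
  assumes S: "compact S"
    and M: "\<And>n. prob_space (M n)" "\<And>n. sets (M n) = sets (restrict_space borel S)"
  obtains r :: "nat \<Rightarrow> nat" and N :: "'a measure"
  where "strict_mono r" "prob_space N" "sets N = sets borel"
    "\<And>(f::'a \<Rightarrow> real) K. \<lbrakk>continuous_on UNIV f; \<And>x. \<bar>f x\<bar> \<le> K\<rbrakk> \<Longrightarrow>
       (\<lambda>n. \<integral>x. f x \<partial>M (r n)) \<longlonglongrightarrow> (\<integral>x. f x \<partial>N)"
proof -
  have sp: "space (M n) = S" for n
    using sets_eq_imp_space_eq[OF M(2)[of n]] by (simp add: space_restrict_space)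
  have ne: "S \<noteq> {}" using prob_space.not_empty[OF M(1)[of 0]] sp by simp
  obtain s :: "'a \<Rightarrow> real" and g :: "real \<Rightarrow> 'a" and a
    where s: "s \<in> borel_measurable borel" "\<And>x. \<bar>s x\<bar> \<le> a" and g: "continuous_on UNIV g"
      and gs: "\<And>x. x \<in> S \<Longrightarrow> g (s x) = x"
    using compact_borel_coding[OF S ne] by metis
  have sM [measurable]: "s \<in> borel_measurable (M n)" for n
    using measurable_restrict_space1[OF s(1), of S] measurable_cong_sets[OF M(2)[of n] refl] by blast
  define L where "L n = distr (M n) borel s" for n
  have rd: "real_distribution (L n)" for n
    unfolding L_def real_distribution_def real_distribution_axioms_def
    by (simp add: prob_space.prob_space_distr[OF M(1)])
  have "tight L"
    unfolding tight_def
  proof (intro conjI allI impI rd)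
    fix e :: real assume "e > 0"
    \<comment> \<open>The interval is open on the left, so 1 is subtracted to keep the value
      \<open>- \<bar>a\<bar>\<close> inside.\<close>
    have "measure (L n) {- \<bar>a\<bar> - 1<..\<bar>a\<bar>} = 1" for n
    proof -
      have "s -` {- \<bar>a\<bar> - 1<..\<bar>a\<bar>} \<inter> space (M n) = space (M n)"
        using s(2) by (auto simp: abs_le_iff) (smt (verit, best) s(2))+
      then show ?thesis
        unfolding L_def by (subst measure_distr) (auto simp: prob_space.prob_space[OF M(1)])
    qed
    then show "\<exists>a b. a < b \<and> (\<forall>n. 1 - e < measure (L n) {a<..b})"
      using \<open>e > 0\<close> by (intro exI[of _ "- \<bar>a\<bar> - 1"] exI[of _ "\<bar>a\<bar>"]) auto
  qed
  from tight_imp_convergent_subsubsequence[OF this strict_mono_id]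
  obtain r L' where r: "strict_mono (r :: nat \<Rightarrow> nat)" and L': "real_distribution L'"
    and wc: "weak_conv_m (L \<circ> r) L'" by auto
  have gm [measurable]: "g \<in> borel_measurable borel" using g by (rule borel_measurable_continuous_onI)
  interpret L': real_distribution L' by fact
  define N where "N = distr L' borel g"
  have gL': "g \<in> measurable L' borel" by simp
  show ?thesis
  proof (rule that[OF r, of N])
    show "prob_space N" unfolding N_def by (rule L'.prob_space_distr) simp
    show "sets N = sets borel" by (simp add: N_def)
    fix f :: "'a \<Rightarrow> real" and K assume f: "continuous_on UNIV f" "\<And>x. \<bar>f x\<bar> \<le> K"
    have fm [measurable]: "f \<in> borel_measurable borel" using f(1) by (rule borel_measurable_continuous_onI)
    have "(\<lambda>n. integral\<^sup>L ((L \<circ> r) n) (\<lambda>t. f (g t))) \<longlonglongrightarrow> integral\<^sup>L L' (\<lambda>t. f (g t))"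
    proof (rule weak_conv_imp_integral_bdd_continuous_conv[OF _ L' wc])
      show "real_distribution ((L \<circ> r) n)" for n using rd by simp
      show "isCont (\<lambda>t. f (g t)) x" for x
        using continuous_on_compose2[OF f(1) g] by (simp add: continuous_on_eq_continuous_at)
      show "norm (f (g x)) \<le> K" for x using f(2) by simp
    qed
    moreover have "integral\<^sup>L ((L \<circ> r) n) (\<lambda>t. f (g t)) = (\<integral>x. f x \<partial>M (r n))" for n
    proof -
      have "integral\<^sup>L ((L \<circ> r) n) (\<lambda>t. f (g t)) = (\<integral>x. f (g (s x)) \<partial>M (r n))"
        unfolding L_def o_def by (subst integral_distr) auto
      also have "\<dots> = (\<integral>x. f x \<partial>M (r n))"
        by (rule Bochner_Integration.integral_cong) (auto simp: sp gs)
      finally show ?thesis .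
    qed
    moreover have "integral\<^sup>L L' (\<lambda>t. f (g t)) = (\<integral>x. f x \<partial>N)"
      unfolding N_def by (subst integral_distr) auto
    ultimately show "(\<lambda>n. \<integral>x. f x \<partial>M (r n)) \<longlonglongrightarrow> (\<integral>x. f x \<partial>N)" by simp
  qed
qed

section \<open>Outer capacity of compact sets and continuity from above\<close>

lemma outer_cap_empty: "outer_cap {} = 0"
  using outer_cap_le[of "{}" "{}"] by (simp add: cap_compact_empty)

lemma outer_cap_ge_cap_compact: "compact F \<Longrightarrow> cap_compact F \<le> outer_cap F"
  unfolding outer_cap_def inner_cap_def by (intro INF_greatest SUP_upper) auto

text \<open>Measures on shrinking neighbourhoods of \<open>F\<close> with energies at most
  \<open>1 / t\<close> have a weak limit on \<open>F\<close>. Features are continuous, so moments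
  converge, and the energy as a sum of squares is lower semicontinuous.\<close>

lemma outer_cap_compact:
  fixes F :: "(complex ^ 'd) set"
  assumes F: "compact F" "F \<subseteq> sphere 0 1"
  shows "outer_cap F = cap_compact F"
proof (cases "F = {}")
  case True
  then show ?thesis by (simp add: outer_cap_empty cap_compact_empty)
next
  case False
  have "outer_cap F \<le> cap_compact F"
  proof (rule dense_le)
    fix u assume u: "u < outer_cap F"
    show "u \<le> cap_compact F"
    proof (cases u)
      case (real t)
      show ?thesis
      proof (cases "t = 0")
        case True
        then show ?thesis using real by simp
      next
        case False
        then have t: "t > 0" using real by simp
        define U where "U n = {x. infdist x F < 1 / real (Suc n)}" for n
        have opU: "open (U n)" for n unfolding U_def by (intro open_Collect_less continuous_intros)
        have "\<exists>M. sphere_prob M \<and> concentrated_on M (U n) \<and> ennreal t < 1 / h2d_energy M" for n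
        proof -
          have "F \<subseteq> U n" by (auto simp: U_def)
          then have "outer_cap F \<le> cap_compact (U n)" using opU F by (intro outer_cap_le)
          then have "ennreal t < cap_compact (U n)" using u real by simp
          then show ?thesis unfolding cap_compact_def less_SUP_iff by auto
        qed
        then obtain M where M: "\<And>n. sphere_prob (M n)" "\<And>n. concentrated_on (M n) (U n)"
          "\<And>n. ennreal t < 1 / h2d_energy (M n)" by metis
        have finM: "h2d_energy (M n) \<noteq> \<top>" for n using M(3)[of n] by auto
        have eM: "energy (M n) \<le> 1 / t" for n
        proof -
          have "1 \<le> energy (M n)" by (rule energy_ge_1[OF M(1) finM])
          moreover have "t < 1 / energy (M n)"
            using M(3)[of n] t unfolding one_divide_h2d_energy[OF M(1) finM] by (simp add: ennreal_less_iff)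
          ultimately show ?thesis using t by (simp add: field_simps)
        qed
        have prM: "prob_space (M n)" "sets (M n) = sets (restrict_space borel (sphere 0 1))" for n
          using M(1)[of n] by (auto simp: sphere_prob_def)
        have smM: "sphere_measure (M n)" for n by (rule sphere_prob_imp_sphere_measure[OF M(1)])
        obtain r N where r: "strict_mono (r :: nat \<Rightarrow> nat)" and N: "prob_space N" "sets N = sets borel"
          and lim: "\<And>(f :: complex ^ 'd \<Rightarrow> real) K. \<lbrakk>continuous_on UNIV f; \<And>x. \<bar>f x\<bar> \<le> K\<rbrakk> \<Longrightarrow>
            (\<lambda>n. \<integral>x. f x \<partial>M (r n)) \<longlonglongrightarrow> (\<integral>x. f x \<partial>N)"
        proof (rule weakly_convergent_subsequence[OF compact_sphere prM])
          fix r :: "nat \<Rightarrow> nat" and N :: "(complex ^ 'd) measure"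
          assume *: "strict_mono r" "prob_space N" "sets N = sets borel"
            and **: "\<And>(f :: complex ^ 'd \<Rightarrow> real) K. \<lbrakk>continuous_on UNIV f; \<And>x. \<bar>f x\<bar> \<le> K\<rbrakk> \<Longrightarrow>
              (\<lambda>n. \<integral>x. f x \<partial>M (r n)) \<longlonglongrightarrow> (\<integral>x. f x \<partial>N)"
          show thesis by (rule that[OF * **])
        qed
        interpret N: prob_space N by fact
        have spN: "space N = UNIV" using sets_eq_imp_space_eq[OF N(2)] by simp
        have mN: "f \<in> borel_measurable N" if "continuous_on UNIV f" for f :: "complex ^ 'd \<Rightarrow> real"
          using borel_measurable_continuous_onI[OF that] measurable_cong_sets[OF N(2) refl] by blast
        \<comment> \<open>A bounded continuous test function vanishing exactly on \<open>F\<close>: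
          its integrals tend to 0, which forces the limit to live on \<open>F\<close>.\<close>
        define \<delta> where "\<delta> x = min 1 (infdist x F)" for x
        have d: "continuous_on UNIV \<delta>" "\<bar>\<delta> x\<bar> \<le> 1" "0 \<le> \<delta> x" for x
          unfolding \<delta>_def by (auto intro!: continuous_intros simp: infdist_nonneg)
        have "(\<lambda>n. \<integral>x. \<delta> x \<partial>M (r n)) \<longlonglongrightarrow> 0"
        proof (rule real_tendsto_sandwich[OF _ _ tendsto_const LIMSEQ_inverse_real_of_nat])
          show "\<forall>\<^sub>F n in sequentially. 0 \<le> (\<integral>x. \<delta> x \<partial>M (r n))"
            using d(3) by (intro always_eventually allI integral_nonneg_AE) auto
          show "\<forall>\<^sub>F n in sequentially. (\<integral>x. \<delta> x \<partial>M (r n)) \<le> inverse (real (Suc n))"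
          proof (intro always_eventually allI)
            fix n
            interpret S: sphere_measure "M (r n)" by (rule smM)
            interpret P: prob_space "M (r n)" by (rule prM)
            have i: "integrable (M (r n)) \<delta>"
              using d by (intro S.integrable_const_bound[of _ 1] S.measurable_borel borel_measurable_continuous_onI) auto
            have "AE x in M (r n). \<delta> x \<le> 1 / real (Suc (r n))"
              using S.AE_concentrated[OF _ M(2)] opU by (auto simp: U_def \<delta>_def elim!: eventually_mono)
            then have "(\<integral>x. \<delta> x \<partial>M (r n)) \<le> (\<integral>x. 1 / real (Suc (r n)) \<partial>M (r n))"
              using i by (intro integral_mono_AE) auto
            also have "\<dots> \<le> inverse (real (Suc n))"
              using seq_suble[OF r, of n] by (simp add: P.prob_space field_simps)
            finally show "(\<integral>x. \<delta> x \<partial>M (r n)) \<le> inverse (real (Suc n))" .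
          qed
        qed
        then have "(\<integral>x. \<delta> x \<partial>N) = 0" using LIMSEQ_unique lim[OF d(1,2)] by blast
        moreover have "integrable N \<delta>"
          using d by (intro N.integrable_const_bound[of _ 1] mN) auto
        ultimately have "AE x in N. \<delta> x = 0"
          using integral_nonneg_eq_0_iff_AE[of N \<delta>] d(3) by auto
        then have aeF: "AE x in N. x \<in> F"
        proof eventually_elim
          case (elim x)
          then have "infdist x F = 0" by (auto simp: \<delta>_def min_def split: if_splits)
          then show ?case using in_closed_iff_infdist_zero[of F x] compact_imp_closed[OF F(1)] \<open>F \<noteq> {}\<close> by blast
        qed
        have sS: "sphere 0 1 \<inter> space N \<in> sets N" by (simp add: N(2) spN)
        \<comment> \<open>Returns from the Borel sets of the whole space to those of the sphere, as
          \<open>sphere_prob\<close> requires.\<close>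
        define V where "V = restrict_space N (sphere 0 1)"
        have V_sets: "sets V = sets (restrict_space borel (sphere 0 1))"
          unfolding V_def by (rule sets_restrict_space_cong[OF N(2)])
        have emV: "emeasure V A = emeasure N A" if "A \<subseteq> sphere 0 1" for A
          unfolding V_def using that sS by (subst emeasure_restrict_space) auto
        have "emeasure N (sphere 0 1) = 1"
          using aeF F(2) by (intro N.emeasure_eq_1_AE) (auto simp: N(2) elim!: eventually_mono)
        then have "emeasure V (space V) = 1" by (simp add: V_def emV[unfolded V_def] space_restrict_space spN)
        then have V: "sphere_prob V" by (simp add: sphere_prob_def V_sets prob_spaceI)
        interpret V: sphere_measure V by (rule sphere_prob_imp_sphere_measure[OF V])
        have "emeasure N (sphere 0 1 - F) = 0"
        proof -
          have "sphere 0 1 - F \<in> sets N" using borel_compact[OF F(1)] by (simp add: N(2))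
          then show ?thesis
            using aeF by (subst AE_iff_measurable[of _ _ "\<lambda>x. x \<notin> sphere 0 1 - F", symmetric])
              (auto simp: spN elim!: eventually_mono)
        qed
        then have V_F: "concentrated_on V F" by (simp add: emV)
        have mom: "(\<lambda>n. moment (M (r n)) j) \<longlonglongrightarrow> moment V j" for j
        proof -
          \<comment> \<open>Features are unbounded on the whole space; clamping at the bound 2 valid
            on the sphere gives an admissible test function with the same moments.\<close>
          define g where "g x = max (-2) (min 2 (feature j x))" for x :: "complex ^ 'd"
          have g: "continuous_on UNIV g" "\<bar>g x\<bar> \<le> 2" for x
            unfolding g_def by (auto intro!: continuous_intros continuous_on_feature)
          have g_eq: "g x = feature j x" if "x \<in> sphere 0 1" for x
            using abs_feature_le[OF that, of j] by (auto simp: g_def)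
          have "(\<integral>x. g x \<partial>M (r n)) = moment (M (r n)) j" for n
            unfolding moment_def using sphere_measure.space_M[OF smM]
            by (intro Bochner_Integration.integral_cong) (auto simp: g_eq)
          moreover have "(\<integral>x. g x \<partial>N) = moment V j"
          proof -
            have "moment V j = (\<integral>x. g x \<partial>V)"
              unfolding moment_def using V.space_M by (intro Bochner_Integration.integral_cong) (auto simp: g_eq)
            also have "\<dots> = (\<integral>x. indicator (sphere 0 1) x *\<^sub>R g x \<partial>N)"
              unfolding V_def by (rule integral_restrict_space[OF sS])
            also have "\<dots> = (\<integral>x. g x \<partial>N)"
            proof (rule integral_cong_AE)
              show "(\<lambda>x. indicator (sphere 0 1) x *\<^sub>R g x) \<in> borel_measurable N"
                by (intro borel_measurable_scaleR borel_measurable_indicator mN[OF g(1)]) (simp add: N(2))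
              show "g \<in> borel_measurable N" by (rule mN[OF g(1)])
              show "AE x in N. indicator (sphere 0 1) x *\<^sub>R g x = g x"
                using aeF by eventually_elim (use F(2) in \<open>auto simp: indicator_def\<close>)
            qed
            finally show ?thesis ..
          qed
          ultimately show ?thesis using lim[OF g] by simp
        qed
        \<comment> \<open>Only finitely many levels pass to the limit at a time; the uniform bound
          on partial sums then bounds the energy.\<close>
        have part: "(\<Sum>n<K. level_energy V n) \<le> 1 / t" for K
        proof (rule LIMSEQ_le_const2)
          show "(\<lambda>k. \<Sum>n<K. level_energy (M (r k)) n) \<longlonglongrightarrow> (\<Sum>n<K. level_energy V n)"
            unfolding level_energy_def by (intro tendsto_intros mom)
          have "(\<Sum>n<K. level_energy (M (r k)) n) \<le> 1 / t" for k
            using sphere_measure.sum_moment_le_energy[OF smM finM, of "levels_below K" "r k"] eM[of "r k"]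
            by (simp add: sum_levels_below level_energy_def)
          then show "\<exists>k0. \<forall>k\<ge>k0. (\<Sum>n<K. level_energy (M (r k)) n) \<le> 1 / t" by blast
        qed
        have smV: "summable (level_energy V)"
          by (rule summableI_nonneg_bounded[OF _ part]) simp
        have finV: "h2d_energy V \<noteq> \<top>"
          unfolding V.h2d_energy_eq_suminf using smV by (subst suminf_ennreal2) auto
        have "energy V \<le> 1 / t"
          unfolding V.finite_energy(2)[OF finV] by (rule suminf_le_const[OF smV part])
        then have "t \<le> 1 / energy V"
          using t energy_ge_1[OF V finV] by (simp add: field_simps)
        then have "ennreal t \<le> 1 / h2d_energy V"
          unfolding one_divide_h2d_energy[OF V finV] by (rule ennreal_leI)
        also have "\<dots> \<le> cap_compact F"
          unfolding cap_compact_def using V V_F by (intro SUP_upper) auto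
        finally show ?thesis using real by simp
      qed
    next
      case top
      then show ?thesis using u by simp
    qed
  qed
  then show ?thesis using outer_cap_ge_cap_compact[OF F(1)] by (rule antisym)
qed

text \<open>Pure compactness: an open set that contains the intersection already contains some
  \<open>E n\<close>.\<close>

lemma outer_cap_decseq_tendsto:
  fixes E :: "nat \<Rightarrow> (complex ^ 'd) set"
  assumes E: "decseq E" "\<And>n. compact (E n)" "\<And>n. E n \<subseteq> sphere 0 1"
  shows "(\<lambda>n. outer_cap (E n)) \<longlonglongrightarrow> outer_cap (\<Inter>n. E n)"
proof -
  have dec: "decseq (\<lambda>n. outer_cap (E n))"
    using E(1) by (auto simp: decseq_def intro: outer_cap_mono)
  have "(INF n. outer_cap (E n)) \<le> outer_cap (\<Inter>n. E n)"
  proof (rule dense_ge)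
    fix u assume "outer_cap (\<Inter>n. E n) < u"
    then obtain U where U: "open U" "(\<Inter>n. E n) \<subseteq> U" "cap_compact U < u"
      using outer_cap_less by metis
    have "\<exists>n. E n \<subseteq> U"
    proof (rule ccontr)
      assume "\<nexists>n. E n \<subseteq> U"
      then have "(\<Inter>n. E n - U) \<noteq> {}"
        using E(1,2) U(1) by (intro compact_nest compact_diff) (auto simp: decseq_def)
      then show False using U(2) by blast
    qed
    then obtain n where "E n \<subseteq> U" ..
    then have "outer_cap (E n) \<le> cap_compact U" using U(1) E(3) by (intro outer_cap_le)
    then show "(INF n. outer_cap (E n)) \<le> u"
      using U(3) by (intro INF_lower2[of n]) auto
  qed
  moreover have "outer_cap (\<Inter>n. E n) \<le> (INF n. outer_cap (E n))"
    by (intro INF_greatest outer_cap_mono) auto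
  ultimately have "outer_cap (\<Inter>n. E n) = (INF n. outer_cap (E n))" by (intro antisym)
  then show ?thesis using LIMSEQ_INF[OF dec] by simp
qed

lemma choquet_capacity_outer_cap:
  "choquet_capacity_on (sphere 0 1) (outer_cap :: (complex ^ 'd) set \<Rightarrow> ennreal)"
  unfolding choquet_capacity_on_def
  by (intro conjI allI impI outer_cap_empty outer_cap_mono outer_cap_decseq_tendsto
      outer_cap_incseq_tendsto) auto

lemma inner_cap_le_outer_cap: "inner_cap E \<le> outer_cap E"
  unfolding outer_cap_def inner_cap_def by (intro INF_greatest SUP_subset_mono) auto

theorem theorem7p4:
  shows "choquet_capacity_on (sphere 0 1) (outer_cap :: (complex ^ 'd) set \<Rightarrow> ennreal)
    \<and> (\<forall>E :: (complex ^ 'd) set. E \<subseteq> sphere 0 1 \<longrightarrow> E \<in> sets borel \<longrightarrow> capacitable E)"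
proof (intro conjI allI impI)
  show "choquet_capacity_on (sphere 0 1) (outer_cap :: (complex ^ 'd) set \<Rightarrow> ennreal)"
    by (rule choquet_capacity_outer_cap)
  fix E :: "(complex ^ 'd) set" assume E: "E \<subseteq> sphere 0 1" "E \<in> sets borel"
  have "outer_cap E \<le> inner_cap E"
  proof (rule dense_le)
    fix t assume "t < outer_cap E"
    then obtain F where F: "compact F" "F \<subseteq> E" "t \<le> outer_cap F"
      using choquet_capacitability[OF compact_sphere choquet_capacity_outer_cap E] by metis
    then have "t \<le> cap_compact F" using outer_cap_compact[of F] E(1) by auto
    also have "\<dots> \<le> inner_cap E" unfolding inner_cap_def using F by (intro SUP_upper) auto
    finally show "t \<le> inner_cap E" .
  qed
  then show "capacitable E" unfolding capacitable_def using inner_cap_le_outer_cap by (rule antisym[rotated])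
qed

end
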